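(* Let $g\ge 2$ be an integer and let $\epsilon>0$. Then $$\sum_{\ell=1}^{\infty}\ell^{2-2g}\,e^{-\epsilon\ell^2}=\sum_{j=0}^{g-1}\frac{(-1)^j}{j!}\,\zeta(2g-2-2j)\,\epsilon^{j}+\frac{(-1)^{g-1}\sqrt{\pi}\,2^{g-2}}{(2g-3)!!}\,\epsilon^{g-3/2}+\sum_{\mathfrak{m}=1}^{\infty}H(\mathfrak{m}),$$ where the function $H=H_{g,\epsilon}$ is the one defined in the context. Moreover, for each fixed integer $\mathfrak{m}\ge 1$, as $\epsilon\to 0^+$, $H(\mathfrak{m})$ has the (Poincaré) asymptotic expansion $$H(\mathfrak{m})\sim e^{-\pi^2\mathfrak{m}^2/\epsilon}\sum_{k=0}^{\infty}\frac{\sqrt{\pi}\,(2g-2)_{2k}}{2^{2k}\,(-\pi^2\mathfrak{m}^2)^{g-1+k}\,k!}\;\epsilon^{2g-5/2+k},$$ meaning that for every integer $K\ge 0$ the difference between $e^{\pi^2\mathfrak{m}^2/\epsilon}H(\mathfrak{m})$ and the sum of the terms with $0\le k\le K$ is $O(\epsilon^{2g-5/2+K+1})$.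
   Context: The left-hand side is the partition function of two-dimensional $\mathrm{SU}(2)$ Yang--Mills theory on a closed surface of genus $g$ and unit area, with coupling $\epsilon$. $\zeta$ is the Riemann zeta function (in particular $\zeta(0)=-\tfrac12$). $(a)_n=a(a+1)\cdots(a+n-1)$ with $(a)_0=1$ is the rising Pochhammer symbol. $n!!$ is the double factorial, with $(-1)!!=1$. $\operatorname{erfc}(x)=1-\operatorname{erf}(x)=\frac{2}{\sqrt\pi}\int_x^\infty e^{-t^2}\,dt$. $H_n(x)$ denotes the physicists' Hermite polynomials, with generating function $e^{2xt-t^2}=\sum_{n\ge0}H_n(x)\,t^n/n!$; note that $H_n$ with an index denotes a Hermite polynomial, whereas $H$ (that is, $H_{g,\epsilon}$) denotes the function below. For given $g\ge2$ and $\epsilon>0$, define for real $p$ $$H(p)=e^{-\pi^2p^2/\epsilon}\,P(p)-\operatorname{erfc}\!\big(\pi p/\sqrt{\epsilon}\big)\,Q'(p),$$ where $P$ is the even polynomial $$P(p)=(-1)^{g-1}(2\pi)^{2g-3}\sqrt{\frac{\epsilon}{\pi}}\sum_{k=0}^{g-2}\Big(-\frac{\epsilon}{2\pi^2}\Big)^{k}p^{2g-4-2k}\sum_{m=0}^{k}\frac{(-1)^m\,(2k-2m-1)!!}{2^m\,m!\,(2g-2m-3)!},$$ and $Q'$ is the odd real polynomial $$Q'(p)=\frac{i\pi\,\epsilon^{g-\frac32}}{(2g-3)!}\,H_{2g-3}\!\Big(\frac{i\pi p}{\sqrt{\epsilon}}\Big).$$ *)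

theory Defs
  imports "HOL-Complex_Analysis.Complex_Analysis" "HOL-Library.Landau_Symbols"
begin

text \<open>
  The Riemann zeta function by analytic continuation: its value at \<open>s \<noteq> 1\<close> is the value of
  the holomorphic extension of the Dirichlet series \<open>\<Sum>n\<ge>1. 1 / n\<^sup>s\<close> from \<open>Re z > 1\<close> to a punctured
  half-plane \<open>{z. Re z > c} - {1}\<close> containing \<open>s\<close>. These domains are connected and
  nested, so the value does not depend on \<open>c\<close>; see \<open>riemann_zeta_eqI\<close> below.
  (At the pole \<open>s = 1\<close> the value is unspecified.)
\<close>

definition zeta_continuation :: "real \<Rightarrow> (complex \<Rightarrow> complex) \<Rightarrow> bool" where
  "zeta_continuation c f \<longleftrightarrow>
     f holomorphic_on ({z. c < Re z} - {1}) \<and>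
     (\<forall>z. c < Re z \<and> 1 < Re z \<longrightarrow> (\<lambda>n. 1 / of_nat (Suc n) powr z) sums f z)"

definition riemann_zeta :: "complex \<Rightarrow> complex" where
  "riemann_zeta s = (THE w. \<exists>c f. c < Re s \<and> zeta_continuation c f \<and> w = f s)"

lemma zeta_continuation_unique:
  assumes f: "zeta_continuation c f" and g: "zeta_continuation d g"
    and s: "c < Re s" "d < Re s" "s \<noteq> 1"
  shows "f s = g s"
proof -
  define A where "A = {z. max c d < Re z} - {1}"
  define U where "U = {z. max 1 (max c d) < Re z}"
  define p where "p = complex_of_real (max 1 (max c d) + 1)"
  have conn: "connected A"
  proof -
    have "connected ({z. max c d < Re z} - {1})"
      by (intro connected_open_delete open_halfspace_Re_gt convex_connected
            convex_halfspace_Re_gt) simp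
    then show ?thesis by (simp add: A_def)
  qed
  have oA: "open A"
    unfolding A_def by (intro open_delete open_halfspace_Re_gt)
  have oU: "open U"
    unfolding U_def by (rule open_halfspace_Re_gt)
  have UA: "U \<subseteq> A" by (auto simp: U_def A_def)
  have pU: "p \<in> U" by (auto simp: p_def U_def max_def)
  have hol: "(\<lambda>z. f z - g z) holomorphic_on A"
    using f g unfolding zeta_continuation_def A_def
    by (intro holomorphic_intros) (auto elim!: holomorphic_on_subset)
  have zero: "f z - g z = 0" if "z \<in> U" for z
  proof -
    have "c < Re z \<and> 1 < Re z" "d < Re z \<and> 1 < Re z"
      using that by (auto simp: U_def)
    then have "(\<lambda>n. 1 / of_nat (Suc n) powr z) sums f z" "(\<lambda>n. 1 / of_nat (Suc n) powr z) sums g z"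
      using f g unfolding zeta_continuation_def by blast+
    then show ?thesis using sums_unique2 by simp
  qed
  have "f s - g s = 0"
  proof (rule analytic_continuation[OF hol oA conn, of U p])
    show "p islimpt U" using oU pU by (simp add: interior_limit_point interior_open)
  qed (use UA pU zero s in \<open>auto simp: A_def\<close>)
  then show ?thesis by simp
qed

lemma riemann_zeta_eqI:
  assumes "zeta_continuation c f" "c < Re s" "s \<noteq> 1"
  shows "riemann_zeta s = f s"
  unfolding riemann_zeta_def
  by (rule the_equality) (use assms zeta_continuation_unique in blast)+

text \<open>Indexed by integers, with value \<open>1\<close> (empty product) for \<open>n \<le> 0\<close>, so that \<open>(-1)!! = 1\<close>.\<close>

definition double_fact :: "int \<Rightarrow> int" where
  "double_fact n = \<Prod>{i \<in> {1..n}. even (n - i)}"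

definition erfc :: "real \<Rightarrow> real" where
  "erfc x = 2 / sqrt pi * (LBINT t:{x..}. exp (- t\<^sup>2))"

text \<open>The coefficient of \<open>t^n / n!\<close> in the generating function \<open>exp (2xt - t\<^sup>2)\<close>.\<close>

definition hermite :: "nat \<Rightarrow> complex \<Rightarrow> complex" where
  "hermite n x = (deriv ^^ n) (\<lambda>t. exp (2 * x * t - t\<^sup>2)) 0"

definition P_fun :: "nat \<Rightarrow> real \<Rightarrow> real \<Rightarrow> real" where
  "P_fun g \<epsilon> p =
     (-1) ^ (g - 1) * (2 * pi) ^ (2 * g - 3) * sqrt (\<epsilon> / pi) *
     (\<Sum>k = 0..g - 2. (- \<epsilon> / (2 * pi\<^sup>2)) ^ k * p ^ (2 * g - 4 - 2 * k) *
        (\<Sum>m = 0..k. (-1) ^ m * of_int (double_fact (2 * int k - 2 * int m - 1)) /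
                       (2 ^ m * fact m * fact (2 * g - 2 * m - 3))))"

text \<open>
  \<open>Q'\<close> is written, as in its defining formula, with a complex Hermite argument; its values
  (and hence those of \<open>H_fun\<close>) are kept as complex numbers, although they are in fact real.
\<close>

definition Q'_fun :: "nat \<Rightarrow> real \<Rightarrow> real \<Rightarrow> complex" where
  "Q'_fun g \<epsilon> p =
     \<i> * of_real (pi * \<epsilon> powr (real g - 3 / 2)) / fact (2 * g - 3) *
     hermite (2 * g - 3) (\<i> * of_real (pi * p / sqrt \<epsilon>))"

definition H_fun :: "nat \<Rightarrow> real \<Rightarrow> real \<Rightarrow> complex" where
  "H_fun g \<epsilon> p =
     of_real (exp (- pi\<^sup>2 * p\<^sup>2 / \<epsilon>) * P_fun g \<epsilon> p) - of_real (erfc (pi * p / sqrt \<epsilon>)) * Q'_fun g \<epsilon> p"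

end

theory Submission
  imports Defs "HOL-Probability.Characteristic_Functions"
begin

text \<open>
  Write \<open>n = g - 1\<close> and \<open>x = pi * p / sqrt \<epsilon>\<close>. Up to the factor \<open>(- 4) ^ n * sqrt pi * \<epsilon> powr (n - 1 / 2)\<close>,
  \<open>H(p)\<close> is the \<open>2 n\<close>-fold iterated integral of \<open>exp (- t\<^sup>2)\<close> from \<open>x\<close> to infinity: the iterated integrals,
  the Hermite polynomials and the polynomial factor \<open>P\<close> all obey the same three-term recurrence.

  Differentiating in \<open>\<epsilon>\<close> therefore turns \<open>H\<close> for \<open>n + 1\<close> into minus \<open>H\<close> for \<open>n\<close>, exactly as it does for the
  terms \<open>exp (- \<epsilon> * l\<^sup>2) / l ^ (2 * n)\<close> of the left-hand side. So the identity follows by induction on \<open>n\<close>,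
  comparing values as \<open>\<epsilon>\<close> tends to \<open>0\<close>, from the case \<open>n = 0\<close>, which is Jacobi's inversion formula for the
  theta function.

  The iterated integral is also the integral of \<open>s ^ (2 * n - 1) * exp (- (x + s)\<^sup>2) / fact (2 * n - 1)\<close> over
  \<open>s \<ge> 0\<close>; expanding \<open>exp (- s\<^sup>2)\<close> by Taylor's formula with remainder gives the asymptotic expansion.
\<close>

section \<open>Jacobi inversion of the theta series\<close>

text \<open>Poisson summation does not apply directly to
  \<open>exp (- \<epsilon> * l\<^sup>2) / l ^ (2 * n)\<close>, because for \<open>n > 0\<close> this
  is singular at \<open>l = 0\<close>. Differentiating in \<open>\<epsilon>\<close> until
  \<open>n = 0\<close> removes the singularity. There the missing term \<open>l = 0\<close> of the
  theta series accounts for \<open>- 1 / 2\<close>, the value of zeta at 0, and the zero frequency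
  of the dual series accounts for the half-integer power of \<open>\<epsilon>\<close>. On the way
  back every integration adds one constant, the limit at \<open>\<epsilon> = 0\<close>, which is a
  convergent zeta sum; integrating the earlier constants again produces the factors
  \<open>(- 1) ^ j / fact j\<close>. The half-integer powers and the nonzero frequencies vanish in
  the limit and add nothing. Thus 0 is the only point at which zeta has to be known outside the
  region of convergence.

  The other obstacle is that \<open>P\<close> and \<open>Q'\<close> are explicit finite sums in
  which no iterated integral is visible. They are therefore recovered from the recurrence: the
  Hermite part and the Gaussian part solve it separately, and only the two initial values of each
  have to be matched.\<close>

lemma gaussian_cos_integral:
  fixes \<epsilon> t :: real
  assumes "\<epsilon> > 0"
  shows "integrable lborel (\<lambda>x. exp (- \<epsilon> * x\<^sup>2) * cos (t * x))"
    and "(LINT x|lborel. exp (- \<epsilon> * x\<^sup>2) * cos (t * x)) = sqrt (pi / \<epsilon>) * exp (- t\<^sup>2 / (4 * \<epsilon>))"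
proof -
  \<comment> \<open>With this scale the standard normal density at \<open>c * x\<close> is
    \<open>exp (- \<epsilon> * x\<^sup>2) / sqrt (2 * pi)\<close>, so the integral becomes a value
    of the normal characteristic function at the rescaled frequency \<open>t / c\<close>.\<close>
  define c where "c = sqrt (2 * \<epsilon>)"
  define \<tau> where "\<tau> = t / c"
  have c: "c > 0" "c\<^sup>2 = 2 * \<epsilon>" using assms by (auto simp: c_def)
  let ?f = "\<lambda>x. std_normal_density x * cos (\<tau> * x)"
  have int_f: "integrable lborel ?f"
    by (rule Bochner_Integration.integrable_bound[of lborel "std_normal_density"])
       (auto simp: abs_mult mult_left_le)
  have int_c: "integrable lborel (\<lambda>x. std_normal_density x *\<^sub>R iexp (\<tau> * x))"
    by (rule Bochner_Integration.integrable_bound[of lborel "std_normal_density"]) auto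
  have "(LINT x|lborel. ?f x) = Re (CLINT x|lborel. std_normal_density x *\<^sub>R iexp (\<tau> * x))"
    by (subst integral_Re[OF int_c, symmetric]) (simp add: Re_exp)
  also have "(CLINT x|lborel. std_normal_density x *\<^sub>R iexp (\<tau> * x)) = char std_normal_distribution \<tau>"
    unfolding char_def by (subst integral_density) (auto simp: mult.commute)
  also have "Re \<dots> = exp (- \<tau>\<^sup>2 / 2)" by (simp add: char_std_normal_distribution)
  finally have val: "(LINT x|lborel. ?f x) = exp (- \<tau>\<^sup>2 / 2)" .
  have eq: "?f (0 + c * x) = (1 / sqrt (2 * pi)) * (exp (- \<epsilon> * x\<^sup>2) * cos (t * x))" for x
    using c by (simp add: normal_density_def \<tau>_def power_mult_distrib)
  have "integrable lborel (\<lambda>x. ?f (0 + c * x))"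
    using lborel_integrable_real_affine[OF int_f, of c 0] c by simp
  then show "integrable lborel (\<lambda>x. exp (- \<epsilon> * x\<^sup>2) * cos (t * x))"
    unfolding eq by (subst (asm) integrable_mult_left_iff) simp
  have "exp (- \<tau>\<^sup>2 / 2) = \<bar>c\<bar> *\<^sub>R (LINT x|lborel. ?f (0 + c * x))"
    unfolding val[symmetric] using c by (intro lborel_integral_real_affine) auto
  also have "\<dots> = c / sqrt (2 * pi) * (LINT x|lborel. exp (- \<epsilon> * x\<^sup>2) * cos (t * x))"
    unfolding eq using c by simp
  finally have "(LINT x|lborel. exp (- \<epsilon> * x\<^sup>2) * cos (t * x)) = sqrt (2 * pi) / c * exp (- \<tau>\<^sup>2 / 2)"
    using c by (simp add: field_simps)
  also have "sqrt (2 * pi) / c = sqrt (pi / \<epsilon>)"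
    unfolding c_def by (simp add: real_sqrt_divide real_sqrt_mult)
  also have "- \<tau>\<^sup>2 / 2 = - t\<^sup>2 / (4 * \<epsilon>)"
    using c by (simp add: \<tau>_def power_divide)
  finally show "(LINT x|lborel. exp (- \<epsilon> * x\<^sup>2) * cos (t * x)) = sqrt (pi / \<epsilon>) * exp (- t\<^sup>2 / (4 * \<epsilon>))" .
qed

text \<open>Symmetric integer bounds are used because the partial sums of the periodized Gaussian
  unfold to exactly these integrals.\<close>

lemma gaussian_cos_integral_tendsto:
  fixes \<epsilon> t :: real
  assumes "\<epsilon> > 0"
  shows "(\<lambda>N. integral {- real N..real N} (\<lambda>x. exp (- \<epsilon> * x\<^sup>2) * cos (t * x)))
           \<longlonglongrightarrow> sqrt (pi / \<epsilon>) * exp (- t\<^sup>2 / (4 * \<epsilon>))"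
proof -
  let ?f = "\<lambda>x. exp (- \<epsilon> * x\<^sup>2) * cos (t * x)"
  have U: "(\<Union>N. {- real N..real N}) = UNIV"
  proof -
    have "x \<in> (\<Union>N. {- real N..real N})" for x
      using real_arch_simple[of "\<bar>x\<bar>"] by (force simp: abs_le_iff)
    then show ?thesis by blast
  qed
  have si: "set_integrable lborel UNIV ?f"
    using gaussian_cos_integral(1)[OF assms] by (simp add: set_integrable_def)
  have "(\<lambda>N. LINT x:{- real N..real N}|lborel. ?f x) \<longlonglongrightarrow> (LINT x:(\<Union>N. {- real N..real N})|lborel. ?f x)"
    by (rule set_integral_cont_up) (use si U in \<open>auto simp: incseq_def\<close>)
  moreover have "(LINT x:{- real N..real N}|lborel. ?f x) = integral {- real N..real N} ?f" for N
    by (rule set_borel_integral_eq_integral(2)) (rule set_integrable_subset[OF si], auto)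
  moreover have "(LINT x:(\<Union>N. {- real N..real N})|lborel. ?f x) = (LINT x|lborel. ?f x)"
    unfolding U by (simp add: set_lebesgue_integral_def)
  ultimately show ?thesis using gaussian_cos_integral(2)[OF assms] by simp
qed

text \<open>Such a \<open>D\<close> is a continuous function of \<open>cos (2 * pi * x)\<close>, and a polynomial in this cosine is a combination of
  the \<open>cos (2 * pi * m * x)\<close>; so by Weierstrass' theorem \<open>D\<close> is orthogonal to itself.\<close>

lemma symmetric_function_zero_if_cos_coeffs_zero:
  fixes D :: "real \<Rightarrow> real"
  assumes cont: "continuous_on {0..1} D"
    and sym: "\<And>x. x \<in> {0..1} \<Longrightarrow> D (1 - x) = D x"
    and coeff: "\<And>m::nat. integral {0..1} (\<lambda>x. D x * cos (2 * pi * real m * x)) = 0"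
    and x: "x \<in> {0..1}"
  shows "D x = 0"
proof -
  have prod0: "integral {0..1} (\<lambda>x. D x * (cos (2 * pi * x) ^ k * cos (2 * pi * real m * x))) = 0" for k m
  proof (induction k arbitrary: m)
    case 0
    then show ?case using coeff by simp
  next
    case (Suc k)
    have iv: "(\<lambda>x. D x * (cos (2 * pi * x) ^ k * cos (2 * pi * real m * x))) integrable_on {0..1}" for m
      by (intro integrable_continuous_real continuous_intros cont)
    \<comment> \<open>\<open>m'\<close> is \<open>\<bar>m - 1\<bar>\<close>; cosine is even, so the
      product formula needs no negative frequency.\<close>
    define m' where "m' = (if m = 0 then 1 else m - 1)"
    have c: "cos (2 * pi * x) * cos (2 * pi * real m * x) =
        (cos (2 * pi * real (Suc m) * x) + cos (2 * pi * real m' * x)) / 2" for x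
    proof (cases "m = 0")
      case False
      then have "2 * pi * real m' * x = 2 * pi * real m * x - 2 * pi * x"
        by (simp add: m'_def of_nat_diff algebra_simps)
      moreover have "2 * pi * real (Suc m) * x = 2 * pi * real m * x + 2 * pi * x"
        by (simp add: algebra_simps)
      ultimately show ?thesis by (simp only: cos_add cos_diff) simp
    qed (simp add: m'_def)
    have "(\<lambda>x. D x * (cos (2 * pi * x) ^ Suc k * cos (2 * pi * real m * x))) =
      (\<lambda>x. (D x * (cos (2 * pi * x) ^ k * cos (2 * pi * real (Suc m) * x))
          + D x * (cos (2 * pi * x) ^ k * cos (2 * pi * real m' * x))) * (1 / 2))"
    proof
      fix x
      have "D x * (cos (2 * pi * x) ^ Suc k * cos (2 * pi * real m * x)) =
        D x * cos (2 * pi * x) ^ k * (cos (2 * pi * x) * cos (2 * pi * real m * x))"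
        by simp
      also have "\<dots> = (D x * (cos (2 * pi * x) ^ k * cos (2 * pi * real (Suc m) * x))
          + D x * (cos (2 * pi * x) ^ k * cos (2 * pi * real m' * x))) * (1 / 2)"
        unfolding c by (simp add: field_simps)
      finally show "D x * (cos (2 * pi * x) ^ Suc k * cos (2 * pi * real m * x)) = \<dots>" .
    qed
    then show ?case
      using Suc.IH[of m'] Suc.IH[of "Suc m"] integral_add[OF iv[of "Suc m"] iv[of m']]
      by simp
  qed
  \<comment> \<open>\<open>arccos\<close> inverts the cosine only on the left half of the unit
    interval; on the right half the symmetry of \<open>D\<close> makes up for it.\<close>
  define \<phi> where "\<phi> = (\<lambda>c. D (arccos c / (2 * pi)))"
  have rng: "arccos c / (2 * pi) \<in> {0..1}" if "c \<in> {-1..1}" for c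
  proof -
    have "0 \<le> arccos c" "arccos c \<le> pi" using that by (auto intro: arccos_lbound arccos_ubound)
    then show ?thesis by (auto simp: field_simps)
  qed
  have cont\<phi>: "continuous_on {-1..1} \<phi>"
    unfolding \<phi>_def
    by (rule continuous_on_compose2[OF cont]) (use rng in \<open>auto intro!: continuous_intros\<close>)
  have \<phi>: "\<phi> (cos (2 * pi * x)) = D x" if x: "x \<in> {0..1}" for x
  proof (cases "x \<le> 1 / 2")
    case True
    then have "arccos (cos (2 * pi * x)) = 2 * pi * x" using x by (intro arccos_cos) auto
    then show ?thesis by (simp add: \<phi>_def)
  next
    case False
    then have "arccos (cos (2 * pi * (1 - x))) = 2 * pi * (1 - x)"
      using x by (intro arccos_cos) auto
    moreover have "cos (2 * pi * (1 - x)) = cos (2 * pi * x)"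
      by (simp add: algebra_simps cos_diff)
    ultimately show ?thesis using sym[OF x] by (simp add: \<phi>_def)
  qed
  have sq: "integral {0..1} (\<lambda>x. (D x)\<^sup>2) \<le> 0"
  proof (rule field_le_epsilon)
    fix e :: real assume e: "e > 0"
    obtain M where M: "M > 0" "\<And>x. x \<in> {0..1} \<Longrightarrow> \<bar>D x\<bar> \<le> M"
      using compact_imp_bounded[OF compact_continuous_image[OF cont compact_Icc]]
      unfolding bounded_pos by (auto simp: image_iff)
    \<comment> \<open>The tolerance \<open>e / M\<close> is chosen so that, after multiplication by
      \<open>D\<close>, which is bounded by \<open>M\<close>, the error is at most
      \<open>e\<close>.\<close>
    obtain q where q: "real_polynomial_function q" "\<And>c. c \<in> {-1..1} \<Longrightarrow> \<bar>\<phi> c - q c\<bar> < e / M"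
      using Stone_Weierstrass_real_polynomial_function[OF compact_Icc cont\<phi>, of "e / M"] e M
      by (metis divide_pos_pos)
    obtain a N where aN: "q = (\<lambda>c. \<Sum>i\<le>N. a i * c ^ i)"
      using q(1) by (auto simp: real_polynomial_function_iff_sum)
    have contq: "continuous_on {0..1} (\<lambda>x. D x * q (cos (2 * pi * x)))"
      unfolding aN by (intro continuous_intros cont)
    have "integral {0..1} (\<lambda>x. D x * q (cos (2 * pi * x))) =
        integral {0..1} (\<lambda>x. \<Sum>i\<le>N. a i * (D x * (cos (2 * pi * x) ^ i * cos (2 * pi * real 0 * x))))"
      unfolding aN by (simp add: sum_distrib_left mult_ac)
    also have "\<dots> = (\<Sum>i\<le>N. integral {0..1} (\<lambda>x. a i * (D x * (cos (2 * pi * x) ^ i * cos (2 * pi * real 0 * x)))))"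
      by (rule integral_sum) (auto intro!: integrable_continuous_real continuous_intros cont)
    also have "\<dots> = 0"
      by (intro sum.neutral ballI) (subst integral_mult_right, subst prod0, simp)
    finally have 0: "integral {0..1} (\<lambda>x. D x * q (cos (2 * pi * x))) = 0" .
    have "integral {0..1} (\<lambda>x. (D x)\<^sup>2) \<le> integral {0..1} (\<lambda>x. D x * q (cos (2 * pi * x)) + e)"
    proof (rule integral_le)
      show "(D x)\<^sup>2 \<le> D x * q (cos (2 * pi * x)) + e" if x: "x \<in> {0..1}" for x
      proof -
        have "\<bar>D x - q (cos (2 * pi * x))\<bar> \<le> e / M"
          using q(2)[of "cos (2 * pi * x)"] \<phi>[OF x] by auto
        then have "\<bar>D x\<bar> * \<bar>D x - q (cos (2 * pi * x))\<bar> \<le> M * (e / M)"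
          using M(2)[OF x] M(1) by (intro mult_mono) auto
        then have "\<bar>D x * (D x - q (cos (2 * pi * x)))\<bar> \<le> e" using M(1) by (simp add: abs_mult)
        then show ?thesis by (simp add: power2_eq_square algebra_simps abs_le_iff)
      qed
    qed (auto intro!: integrable_continuous_real continuous_intros cont contq)
    also have "\<dots> = 0 + e"
      by (subst integral_add) (auto intro!: integrable_continuous_real contq simp: 0)
    finally show "integral {0..1} (\<lambda>x. (D x)\<^sup>2) \<le> 0 + e" .
  qed
  have "integral {0..1} (\<lambda>x. (D x)\<^sup>2) = 0"
    using sq by (intro antisym integral_nonneg integrable_continuous_real continuous_intros cont) auto
  moreover have "continuous_on {0..1} (\<lambda>x. (D x)\<^sup>2)" by (intro continuous_intros cont)
  ultimately show ?thesis
    using integral_eq_0_iff[of 0 1 "\<lambda>x. (D x)\<^sup>2"] x by auto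
qed

text \<open>Used both for the periodized Gaussian and for its candidate cosine series. A summable
  majorant gives uniform convergence, which survives multiplication by the bounded weight
  \<open>w\<close> and permits termwise integration.\<close>

lemma integral_suminf_times:
  fixes u :: "nat \<Rightarrow> real \<Rightarrow> real"
  assumes bd: "\<And>l x. x \<in> {0..1} \<Longrightarrow> \<bar>u l x\<bar> \<le> B l" and B: "summable B"
    and cu: "\<And>l. continuous_on {0..1} (u l)" and cw: "continuous_on {0..1} w"
  shows "continuous_on {0..1} (\<lambda>x. \<Sum>l. u l x)"
    and "(\<lambda>l. integral {0..1} (\<lambda>x. u l x * w x)) sums integral {0..1} (\<lambda>x. (\<Sum>l. u l x) * w x)"
proof -
  have ul: "uniform_limit {0..1} (\<lambda>N x. \<Sum>l<N. u l x) (\<lambda>x. \<Sum>l. u l x) sequentially"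
    by (rule Weierstrass_m_test[OF _ B]) (use bd in auto)
  show cS: "continuous_on {0..1} (\<lambda>x. \<Sum>l. u l x)"
    by (rule uniform_limit_theorem[OF _ ul]) (auto intro!: always_eventually continuous_intros cu)
  have "uniform_limit {0..1} (\<lambda>N x. (\<Sum>l<N. u l x) * w x) (\<lambda>x. (\<Sum>l. u l x) * w x) sequentially"
    by (rule uniform_lim_mult[OF ul uniform_limit_const])
       (auto intro!: compact_imp_bounded compact_continuous_image cS cw)
  then obtain I J where I: "\<And>N. ((\<lambda>x. (\<Sum>l<N. u l x) * w x) has_integral I N) {0..1}"
    and J: "((\<lambda>x. (\<Sum>l. u l x) * w x) has_integral J) {0..1}" "I \<longlonglongrightarrow> J"
    by (rule uniform_limit_integral) (auto intro!: continuous_intros cu cw)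
  have "I N = (\<Sum>l<N. integral {0..1} (\<lambda>x. u l x * w x))" for N
  proof -
    have "I N = integral {0..1} (\<lambda>x. \<Sum>l<N. u l x * w x)"
      using I[of N] by (simp add: integral_unique sum_distrib_right)
    also have "\<dots> = (\<Sum>l<N. integral {0..1} (\<lambda>x. u l x * w x))"
      by (rule integral_sum) (auto intro!: integrable_continuous_real continuous_intros cu cw)
    finally show ?thesis .
  qed
  then have "I = (\<lambda>N. \<Sum>l<N. integral {0..1} (\<lambda>x. u l x * w x))" by blast
  then show "(\<lambda>l. integral {0..1} (\<lambda>x. u l x * w x)) sums integral {0..1} (\<lambda>x. (\<Sum>l. u l x) * w x)"
    using J(2) integral_unique[OF J(1)] by (simp add: sums_def)
qed

lemma integral_cos_int:
  fixes j :: int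
  shows "integral {0..1} (\<lambda>x. cos (2 * pi * of_int j * x)) = (if j = 0 then 1 else 0)"
proof (cases "j = 0")
  case False
  have "((\<lambda>x. cos (2 * pi * of_int j * x)) has_integral
      (sin (2 * pi * of_int j * 1) / (2 * pi * of_int j) - sin (2 * pi * of_int j * 0) / (2 * pi * of_int j))) {0..1}"
    using False
    by (intro fundamental_theorem_of_calculus)
       (auto intro!: derivative_eq_intros simp flip: has_real_derivative_iff_has_vector_derivative)
  then show ?thesis using False by (simp add: integral_unique)
qed simp

text \<open>The product formula reduces this to the frequencies \<open>a - b\<close> and
  \<open>a + b\<close>, the first of which may be negative. Positivity of \<open>a\<close> keeps the
  second one nonzero.\<close>

lemma integral_cos_times_cos:
  fixes a b :: nat
  assumes "a > 0"
  shows "integral {0..1} (\<lambda>x. cos (2 * pi * real a * x) * cos (2 * pi * real b * x)) = (if a = b then 1 / 2 else 0)"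
proof -
  have "integral {0..1} (\<lambda>x. cos (2 * pi * real a * x) * cos (2 * pi * real b * x)) =
     integral {0..1} (\<lambda>x. (1 / 2) * (cos (2 * pi * of_int (int a - int b) * x) + cos (2 * pi * of_int (int a + int b) * x)))"
    by (rule arg_cong[where f = "integral {0..1}"], rule ext) (subst cos_times_cos, simp add: algebra_simps)
  also have "\<dots> = (1 / 2) * (integral {0..1} (\<lambda>x. cos (2 * pi * of_int (int a - int b) * x))
       + integral {0..1} (\<lambda>x. cos (2 * pi * of_int (int a + int b) * x)))"
    unfolding integral_mult_right
    by (subst integral_add) (auto intro!: integrable_continuous_real continuous_intros)
  also have "\<dots> = (if a = b then 1 / 2 else 0)"
    unfolding integral_cos_int using assms by auto
  finally show ?thesis .
qed

text \<open>Since \<open>k \<le> k\<^sup>2 \<le> y\<^sup>2\<close> for natural \<open>k\<close>, a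
  geometric series dominates every Gaussian series that occurs below.\<close>

lemma exp_neg_square_le_power:
  fixes c :: real
  assumes "c \<ge> 0" "real k \<le> y"
  shows "exp (- (c * y\<^sup>2)) \<le> exp (- c) ^ k"
proof -
  have "real k \<le> real k ^ 2" by (cases k) (auto simp: power2_eq_square field_simps)
  also have "\<dots> \<le> y\<^sup>2" using assms by (intro power_mono) auto
  finally have "c * real k \<le> c * y\<^sup>2" using assms by (intro mult_left_mono) auto
  then have "exp (- (c * y\<^sup>2)) \<le> exp (real k * (- c))" by (simp add: mult.commute)
  then show ?thesis by (simp only: exp_of_nat_mult)
qed

lemma summable_exp_neg_square:
  fixes c :: real
  assumes "c > 0"
  shows "summable (\<lambda>l. exp (- c * (real (Suc l))\<^sup>2))"
  by (rule summable_comparison_test'[of "\<lambda>l. exp (- c) ^ Suc l" 0])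
     (use assms in \<open>auto intro!: exp_neg_square_le_power simp del: power_Suc of_nat_Suc
        simp: summable_Suc_iff[where f = "\<lambda>k. exp (- c) ^ k"] summable_geometric\<close>)

text \<open>The translates by \<open>l\<close> and by \<open>- l - 1\<close> are paired, so that a
  sum over the naturals runs through all integers. The cosine has period 1; hence integrating one
  pair over the unit interval gives the integrals over the cells \<open>[l, l + 1]\<close> and
  \<open>[- l - 1, - l]\<close>, and \<open>N\<close> such pairs tile
  \<open>[- N, N]\<close>.\<close>

lemma periodized_gaussian_cos_coeffs:
  fixes \<epsilon> t :: real and m :: nat
  assumes "\<epsilon> > 0"
  shows "(\<lambda>l. integral {0..1} (\<lambda>x. (exp (- \<epsilon> * (x + real l)\<^sup>2) + exp (- \<epsilon> * (x - real (Suc l))\<^sup>2)) * cos (2 * pi * real m * x)))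
           sums (sqrt (pi / \<epsilon>) * exp (- pi\<^sup>2 * (real m)\<^sup>2 / \<epsilon>))"
proof -
  define f where "f = (\<lambda>x. exp (- \<epsilon> * x\<^sup>2) * cos (2 * pi * real m * x))"
  have cf: "continuous_on S f" for S unfolding f_def by (intro continuous_intros)
  have int: "f integrable_on {a..b}" for a b by (intro integrable_continuous_real cf)
  have cs: "cos (2 * pi * real m * (x + of_int j)) = cos (2 * pi * real m * x)" for x and j :: int
  proof -
    have "2 * pi * real m * (x + of_int j) = 2 * pi * real m * x + 2 * pi * of_int (int m * j)"
      by (simp add: algebra_simps)
    then show ?thesis by (simp only: cos_add cos_int_2pin sin_int_2pin)
  qed
  have sh: "integral {0..1} (\<lambda>x. f (x + c)) = integral {c..1 + c} f" for c
    using integral_shift_Icc_real[of 0 1 f c] by (simp add: o_def add_ac)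
  have trm: "integral {0..1} (\<lambda>x. (exp (- \<epsilon> * (x + real l)\<^sup>2) + exp (- \<epsilon> * (x - real (Suc l))\<^sup>2)) * cos (2 * pi * real m * x))
     = integral {real l..real l + 1} f + integral {- real l - 1..- real l} f" for l
  proof -
    have "(exp (- \<epsilon> * (x + real l)\<^sup>2) + exp (- \<epsilon> * (x - real (Suc l))\<^sup>2)) * cos (2 * pi * real m * x)
      = f (x + real l) + f (x + (- real l - 1))" for x
      unfolding f_def using cs[of x "int l"] cs[of x "- int l - 1"]
      by (simp add: distrib_right) (simp add: algebra_simps)
    then have "integral {0..1} (\<lambda>x. (exp (- \<epsilon> * (x + real l)\<^sup>2) + exp (- \<epsilon> * (x - real (Suc l))\<^sup>2)) * cos (2 * pi * real m * x))
       = integral {0..1} (\<lambda>x. f (x + real l) + f (x + (- real l - 1)))" by simp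
    also have "\<dots> = integral {0..1} (\<lambda>x. f (x + real l)) + integral {0..1} (\<lambda>x. f (x + (- real l - 1)))"
      unfolding f_def by (intro integral_add integrable_continuous_real continuous_intros)
    also have "\<dots> = integral {real l..real l + 1} f + integral {- real l - 1..- real l} f"
      unfolding sh by (simp add: add.commute)
    finally show ?thesis .
  qed
  have "(\<Sum>l<N. integral {real l..real l + 1} f + integral {- real l - 1..- real l} f) = integral {- real N..real N} f" for N
  proof (induction N)
    case (Suc N)
    have S: "- real (Suc N) = - real N - 1" "real (Suc N) = real N + 1" by simp_all
    have "integral {- real (Suc N)..real (Suc N)} f = integral {- real N - 1..- real N} f + integral {- real N..real N + 1} f"
      using Henstock_Kurzweil_Integration.integral_combine[where a = "- real N - 1" and c = "- real N" and b = "real N + 1" and f = f] int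
      unfolding S by simp
    also have "integral {- real N..real N + 1} f = integral {- real N..real N} f + integral {real N..real N + 1} f"
      using Henstock_Kurzweil_Integration.integral_combine[where a = "- real N" and c = "real N" and b = "real N + 1" and f = f] int by simp
    finally show ?case using Suc by simp
  qed simp
  then show ?thesis
    unfolding sums_def trm
    using gaussian_cos_integral_tendsto[OF assms, of "2 * pi * real m"]
    by (simp add: f_def power_mult_distrib)
qed

text \<open>\<open>D\<close> is the periodized Gaussian minus its expected cosine series. All its
  cosine coefficients vanish, so \<open>D\<close> vanishes by uniqueness; no theorem on pointwise
  convergence of Fourier series enters. The formula is \<open>D 0 = 0\<close>.\<close>

theorem theta_inversion:
  fixes \<epsilon> :: real
  assumes \<epsilon>: "\<epsilon> > 0"
  shows "(\<Sum>l. exp (- \<epsilon> * (real (Suc l))\<^sup>2)) =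
      - 1 / 2 + sqrt (pi / \<epsilon>) / 2 + sqrt (pi / \<epsilon>) * (\<Sum>m. exp (- pi\<^sup>2 * (real (Suc m))\<^sup>2 / \<epsilon>))"
proof -
  define u where "u = (\<lambda>l x. exp (- \<epsilon> * (x + real l)\<^sup>2) + exp (- \<epsilon> * (x - real (Suc l))\<^sup>2))"
  define v where "v = (\<lambda>m x. exp (- pi\<^sup>2 * (real (Suc m))\<^sup>2 / \<epsilon>) * cos (2 * pi * real (Suc m) * x))"
  define D where "D = (\<lambda>x. (\<Sum>l. u l x) - sqrt (pi / \<epsilon>) * (1 + 2 * (\<Sum>m. v m x)))"
  have bu: "\<bar>u l x\<bar> \<le> 2 * exp (- \<epsilon>) ^ l" if "x \<in> {0..1}" for l x
  proof -
    have "exp (- \<epsilon> * (real (Suc l) - x)\<^sup>2) \<le> exp (- \<epsilon>) ^ l" "exp (- \<epsilon> * (x + real l)\<^sup>2) \<le> exp (- \<epsilon>) ^ l"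
      using that \<epsilon> by (auto intro!: exp_neg_square_le_power)
    then show ?thesis
      by (simp only: u_def power2_commute[of x]) simp
  qed
  have su: "summable (\<lambda>l. 2 * exp (- \<epsilon>) ^ l)" using \<epsilon> by (intro summable_mult summable_geometric) auto
  have cu: "continuous_on {0..1} (u l)" for l unfolding u_def by (intro continuous_intros)
  have sv: "summable (\<lambda>m. exp (- pi\<^sup>2 * (real (Suc m))\<^sup>2 / \<epsilon>))"
    using summable_exp_neg_square[of "pi\<^sup>2 / \<epsilon>"] \<epsilon> by simp
  have bv: "\<bar>v m x\<bar> \<le> exp (- pi\<^sup>2 * (real (Suc m))\<^sup>2 / \<epsilon>)" for m x
    by (simp add: v_def abs_mult mult_left_le)
  have cv: "continuous_on {0..1} (v l)" for l unfolding v_def using \<epsilon> by (intro continuous_intros) auto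
  have cw: "continuous_on {0..1} (\<lambda>x. cos (2 * pi * real k * x))" for k by (intro continuous_intros)
  have U: "continuous_on {0..1} (\<lambda>x. \<Sum>l. u l x)"
    "(\<lambda>l. integral {0..1} (\<lambda>x. u l x * cos (2 * pi * real k * x))) sums
       integral {0..1} (\<lambda>x. (\<Sum>l. u l x) * cos (2 * pi * real k * x))" for k
    by (rule integral_suminf_times; use bu su cu cw in blast)+
  have V: "continuous_on {0..1} (\<lambda>x. \<Sum>l. v l x)"
    "(\<lambda>l. integral {0..1} (\<lambda>x. v l x * cos (2 * pi * real k * x))) sums
       integral {0..1} (\<lambda>x. (\<Sum>l. v l x) * cos (2 * pi * real k * x))" for k
    by (rule integral_suminf_times; use bv sv cv cw in blast)+
  have intU: "integral {0..1} (\<lambda>x. (\<Sum>l. u l x) * cos (2 * pi * real k * x)) = sqrt (pi / \<epsilon>) * exp (- pi\<^sup>2 * (real k)\<^sup>2 / \<epsilon>)" for k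
  proof (rule sums_unique2[OF U(2)])
    show "(\<lambda>l. integral {0..1} (\<lambda>x. u l x * cos (2 * pi * real k * x))) sums (sqrt (pi / \<epsilon>) * exp (- pi\<^sup>2 * (real k)\<^sup>2 / \<epsilon>))"
      unfolding u_def by (rule periodized_gaussian_cos_coeffs[OF \<epsilon>])
  qed
  have intV: "integral {0..1} (\<lambda>x. (\<Sum>m. v m x) * cos (2 * pi * real k * x)) =
     (if k = 0 then 0 else exp (- pi\<^sup>2 * (real k)\<^sup>2 / \<epsilon>) / 2)" for k
  proof -
    \<comment> \<open>The index set has at most one element and is empty for \<open>k = 0\<close>,
      which lets one finite sum cover both cases.\<close>
    have "integral {0..1} (\<lambda>x. v m x * cos (2 * pi * real k * x)) =
       (if m \<in> {j. Suc j = k} then exp (- pi\<^sup>2 * (real (Suc m))\<^sup>2 / \<epsilon>) / 2 else 0)" for m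
      unfolding v_def mult.assoc[of "exp _"] integral_mult_right
      by (subst integral_cos_times_cos) (auto simp del: of_nat_Suc)
    moreover have "finite {j. Suc j = k}" by (rule finite_subset[of _ "{..k}"]) auto
    ultimately have "(\<lambda>m. integral {0..1} (\<lambda>x. v m x * cos (2 * pi * real k * x))) sums
       (\<Sum>m\<in>{j. Suc j = k}. exp (- pi\<^sup>2 * (real (Suc m))\<^sup>2 / \<epsilon>) / 2)"
      using sums_If_finite_set by (simp only:)
    then have "integral {0..1} (\<lambda>x. (\<Sum>m. v m x) * cos (2 * pi * real k * x)) =
       (\<Sum>m\<in>{j. Suc j = k}. exp (- pi\<^sup>2 * (real (Suc m))\<^sup>2 / \<epsilon>) / 2)"
      using V(2)[of k] sums_unique2 by blast
    also have "\<dots> = (if k = 0 then 0 else exp (- pi\<^sup>2 * (real k)\<^sup>2 / \<epsilon>) / 2)"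
      by (cases k) auto
    finally show ?thesis .
  qed
  have "D 0 = 0"
  proof (rule symmetric_function_zero_if_cos_coeffs_zero[where D = D])
    show "continuous_on {0..1} D"
      unfolding D_def by (intro continuous_intros U(1) V(1))
    show "D (1 - x) = D x" for x
    proof -
      \<comment> \<open>The reflection exchanges the two exponentials of the pair.\<close>
      have "u l (1 - x) = u l x" for l
        unfolding u_def by (simp add: add.commute) (simp add: power2_commute[of "1 + real l"] algebra_simps power2_eq_square)
      moreover have "v m (1 - x) = v m x" for m
      proof -
        have "2 * pi * real (Suc m) * (1 - x) = 2 * pi * of_int (int (Suc m)) - 2 * pi * real (Suc m) * x"
          by (simp add: algebra_simps)
        then show ?thesis unfolding v_def by (simp only: cos_diff cos_int_2pin sin_int_2pin) simp
      qed
      ultimately show ?thesis by (simp add: D_def)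
    qed
    show "integral {0..1} (\<lambda>x. D x * cos (2 * pi * real k * x)) = 0" for k :: nat
    proof -
      have add: "integral {0..1} (\<lambda>x. sqrt (pi / \<epsilon>) * cos (2 * pi * of_int (int k) * x) + (2 * sqrt (pi / \<epsilon>)) * ((\<Sum>m. v m x) * cos (2 * pi * real k * x)))
         = integral {0..1} (\<lambda>x. sqrt (pi / \<epsilon>) * cos (2 * pi * of_int (int k) * x))
           + integral {0..1} (\<lambda>x. (2 * sqrt (pi / \<epsilon>)) * ((\<Sum>m. v m x) * cos (2 * pi * real k * x)))"
        by (intro integral_add integrable_continuous_real continuous_intros U(1) V(1))
      have "(\<lambda>x. D x * cos (2 * pi * real k * x)) = (\<lambda>x. (\<Sum>l. u l x) * cos (2 * pi * real k * x)
         - (sqrt (pi / \<epsilon>) * cos (2 * pi * of_int (int k) * x) + (2 * sqrt (pi / \<epsilon>)) * ((\<Sum>m. v m x) * cos (2 * pi * real k * x))))"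
        by (simp add: D_def algebra_simps)
      then have "integral {0..1} (\<lambda>x. D x * cos (2 * pi * real k * x)) = integral {0..1} (\<lambda>x. (\<Sum>l. u l x) * cos (2 * pi * real k * x)
         - (sqrt (pi / \<epsilon>) * cos (2 * pi * of_int (int k) * x) + (2 * sqrt (pi / \<epsilon>)) * ((\<Sum>m. v m x) * cos (2 * pi * real k * x))))"
        by (simp only:)
      also have "\<dots> = integral {0..1} (\<lambda>x. (\<Sum>l. u l x) * cos (2 * pi * real k * x))
         - integral {0..1} (\<lambda>x. sqrt (pi / \<epsilon>) * cos (2 * pi * of_int (int k) * x) + (2 * sqrt (pi / \<epsilon>)) * ((\<Sum>m. v m x) * cos (2 * pi * real k * x)))"
        by (intro integral_diff integrable_continuous_real continuous_intros U(1) V(1))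
      also have "\<dots> = 0"
        unfolding add integral_mult_right intU intV integral_cos_int by simp
      finally show ?thesis .
    qed
  qed auto
  \<comment> \<open>At \<open>x = 0\<close> the first exponentials run over
    \<open>0, 1, 2, ...\<close> and the second over \<open>1, 2, ...\<close>: zero is counted once,
    every other square twice.\<close>
  moreover have "(\<Sum>l. u l 0) = 1 + 2 * (\<Sum>l. exp (- \<epsilon> * (real (Suc l))\<^sup>2))"
  proof -
    have s: "summable (\<lambda>l. exp (- \<epsilon> * (real (Suc l))\<^sup>2))" by (rule summable_exp_neg_square[OF \<epsilon>])
    then have s0: "summable (\<lambda>l. exp (- \<epsilon> * (real l)\<^sup>2))" by (subst (asm) summable_Suc_iff)
    have "(\<Sum>l. u l 0) = (\<Sum>l. exp (- \<epsilon> * (real l)\<^sup>2) + exp (- \<epsilon> * (real (Suc l))\<^sup>2))"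
      unfolding u_def by (simp only: add_0_left power2_commute[of 0] diff_zero)
    also have "\<dots> = (\<Sum>l. exp (- \<epsilon> * (real l)\<^sup>2)) + (\<Sum>l. exp (- \<epsilon> * (real (Suc l))\<^sup>2))"
      by (rule suminf_add[symmetric, OF s0 s])
    also have "(\<Sum>l. exp (- \<epsilon> * (real l)\<^sup>2)) = (\<Sum>l. exp (- \<epsilon> * (real (Suc l))\<^sup>2)) + 1"
      using suminf_split_head[OF s0] by simp
    finally show ?thesis by simp
  qed
  moreover have "(\<Sum>m. v m 0) = (\<Sum>m. exp (- pi\<^sup>2 * (real (Suc m))\<^sup>2 / \<epsilon>))"
    by (simp add: v_def)
  ultimately show ?thesis unfolding D_def by (simp add: algebra_simps)
qed

section \<open>Iterated integrals of the complementary error function\<close>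

text \<open>Indices are shifted by one against the usual notation: \<open>ierfc (Suc k)\<close> is \<open>\<surd>\<pi> / 2\<close> times the \<open>k\<close>-fold
  iterated integral of \<open>erfc\<close>.\<close>

fun ierfc :: "nat \<Rightarrow> real \<Rightarrow> real" where
  "ierfc 0 x = exp (- x\<^sup>2)"
| "ierfc (Suc 0) x = sqrt pi / 2 * erfc x"
| "ierfc (Suc (Suc k)) x = (ierfc k x - 2 * x * ierfc (Suc k) x) / (2 * real (Suc k))"

lemma integrable_gaussian: "integrable lborel (\<lambda>t::real. exp (- t\<^sup>2))"
proof -
  have "integrable lborel (\<lambda>t::real. sqrt pi * normal_density 0 (1 / sqrt 2) t)"
    by (intro integrable_mult_right integrable_normal_density) auto
  moreover have "(\<lambda>t::real. sqrt pi * normal_density 0 (1 / sqrt 2) t) = (\<lambda>t. exp (- t\<^sup>2))"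
    by (auto simp: normal_density_def power_divide real_sqrt_divide fun_eq_iff)
  ultimately show ?thesis by simp
qed

lemma erfc_has_real_derivative:
  "(erfc has_real_derivative (- 2 / sqrt pi * exp (- x\<^sup>2))) (at x)"
proof -
  let ?f = "\<lambda>t::real. exp (- t\<^sup>2)"
  have si: "set_integrable lborel {y..} ?f" for y :: real
    unfolding set_integrable_def
    by (rule integrable_mult_indicator[OF _ integrable_gaussian]) auto
  note hk = set_borel_integral_eq_integral[OF si]
  \<comment> \<open>A base point to the left of \<open>x\<close> turns the improper integral into a
    constant minus an integral over a bounded interval, to which the fundamental theorem of calculus
    applies.\<close>
  define a where "a = x - 1"
  have erfc_eq: "erfc y = erfc a - 2 / sqrt pi * integral {a..y} ?f" if "a \<le> y" for y
  proof -
    have "(?f has_integral integral {a..y} ?f) {a..y}"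
      by (intro integrable_integral integrable_continuous_real continuous_intros)
    moreover have "(?f has_integral integral {y..} ?f) {y..}" by (rule integrable_integral[OF hk(1)])
    moreover have U: "{a..y} \<union> {y..} = {a..}" and I: "{a..y} \<inter> {y..} = {y}" using that by auto
    have "negligible ({a..y} \<inter> {y..})" unfolding I by simp
    ultimately have "(?f has_integral (integral {a..y} ?f + integral {y..} ?f)) {a..}"
      unfolding U[symmetric] by (rule has_integral_Un)
    then have "integral {a..} ?f = integral {a..y} ?f + integral {y..} ?f" by (rule integral_unique)
    then show ?thesis unfolding erfc_def hk(2) by (simp add: algebra_simps)
  qed
  have "((\<lambda>y. integral {a..y} ?f) has_real_derivative ?f x) (at x within {a..x + 1})"
    by (rule integral_has_real_derivative) (auto simp: a_def intro!: continuous_intros)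
  moreover have "at x within {a..x + 1} = at x"
    by (rule at_within_interior) (auto simp: a_def)
  ultimately have "((\<lambda>y. integral {a..y} ?f) has_real_derivative ?f x) (at x)" by simp
  then have "((\<lambda>y. erfc a - 2 / sqrt pi * integral {a..y} ?f) has_real_derivative (0 - 2 / sqrt pi * ?f x)) (at x)"
    by (intro DERIV_diff DERIV_const DERIV_cmult)
  then have "((\<lambda>y. erfc a - 2 / sqrt pi * integral {a..y} ?f) has_real_derivative (- 2 / sqrt pi * ?f x)) (at x)"
    by simp
  then show ?thesis
  proof (rule has_field_derivative_transform_within_open[where S = "{a<..}"])
    show "erfc a - 2 / sqrt pi * integral {a..y} ?f = erfc y" if "y \<in> {a<..}" for y
      using erfc_eq[of y, symmetric] that by simp
  qed (auto simp: a_def)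
qed

lemma has_real_derivative_ierfc_step:
  fixes f g :: "real \<Rightarrow> real"
  assumes "(f has_real_derivative f') (at x)" "(g has_real_derivative g') (at x)"
  shows "((\<lambda>x. (f x - 2 * x * g x) / c) has_real_derivative (f' - (2 * g x + 2 * x * g')) / c) (at x)"
  by (intro DERIV_cdivide DERIV_diff assms DERIV_cong[OF DERIV_mult[OF DERIV_cmult_Id assms(2)]])
     simp

lemma ierfc_Suc_Suc: "2 * real (Suc k) * ierfc (Suc (Suc k)) x = ierfc k x - 2 * x * ierfc (Suc k) x"
  by (simp del: ierfc.simps(1,2))

text \<open>Differentiating the recurrence yields the recurrence one index lower, plus one extra
  term \<open>2 * ierfc (Suc k) x\<close> from the factor \<open>2 * x\<close>. That term raises the
  coefficient \<open>2 * k\<close> to \<open>2 * (k + 1)\<close>, which the denominator cancels. The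
  initial case \<open>k = 1\<close> works because \<open>exp (- x\<^sup>2)\<close> has derivative
  \<open>- 2 * x * exp (- x\<^sup>2)\<close>.\<close>

lemma ierfc_has_real_derivative:
  "(ierfc (Suc k) has_real_derivative - ierfc k x) (at x)"
proof (induction k rule: less_induct)
  case (less k)
  consider "k = 0" | "k = Suc 0" | j where "k = Suc (Suc j)"
    by (metis not0_implies_Suc)
  then show ?case
  proof cases
    case 1
    have "((\<lambda>x. sqrt pi / 2 * erfc x) has_real_derivative sqrt pi / 2 * (- 2 / sqrt pi * exp (- x\<^sup>2))) (at x)"
      by (intro DERIV_cmult erfc_has_real_derivative)
    moreover have "ierfc (Suc 0) = (\<lambda>x. sqrt pi / 2 * erfc x)" by (rule ext) simp
    ultimately show ?thesis using 1 by simp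
  next
    case 2
    have e: "(ierfc 0 has_real_derivative - 2 * x * exp (- x\<^sup>2)) (at x)"
      unfolding ierfc.simps(1)[abs_def] by (auto intro!: derivative_eq_intros)
    have "(ierfc (Suc 0) has_real_derivative - ierfc 0 x) (at x)" using less[of 0] 2 by (simp del: ierfc.simps)
    note d = has_real_derivative_ierfc_step[OF e this, of "2 * real (Suc 0)"]
    have eq: "ierfc (Suc (Suc 0)) = (\<lambda>x. (ierfc 0 x - 2 * x * ierfc (Suc 0) x) / (2 * real (Suc 0)))"
      by (rule ext) (rule ierfc.simps(3))
    have "(- 2 * x * exp (- x\<^sup>2) - (2 * ierfc (Suc 0) x + 2 * x * - ierfc 0 x)) / (2 * real (Suc 0)) = - ierfc (Suc 0) x"
      by (simp del: ierfc.simps(2,3))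
    then show ?thesis using d unfolding 2 eq by (simp only:)
  next
    case 3
    have "(ierfc (Suc j) has_real_derivative - ierfc j x) (at x)"
      "(ierfc (Suc (Suc j)) has_real_derivative - ierfc (Suc j) x) (at x)" using less[of j] less[of "Suc j"] 3
      by (simp_all del: ierfc.simps)
    note d = has_real_derivative_ierfc_step[OF this, of "2 * real (Suc (Suc j))"]
    have eq: "ierfc (Suc (Suc (Suc j))) =
        (\<lambda>x. (ierfc (Suc j) x - 2 * x * ierfc (Suc (Suc j)) x) / (2 * real (Suc (Suc j))))"
      by (rule ext) (rule ierfc.simps(3))
    have "(- ierfc j x - (2 * ierfc (Suc (Suc j)) x + 2 * x * - ierfc (Suc j) x)) / (2 * real (Suc (Suc j)))
        = - ierfc (Suc (Suc j)) x"
      using ierfc_Suc_Suc[of j x] by (simp add: field_simps del: ierfc.simps)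
    then show ?thesis using d unfolding 3 eq by (simp only:)
  qed
qed

section \<open>Moment integrals, bounds and asymptotics of the iterated integrals\<close>

lemma power_exp_integral:
  fixes c :: real
  assumes c: "c > 0"
  shows "set_integrable lborel {0..} (\<lambda>s. s ^ k * exp (- (c * s)))"
    and "(LINT s:{0..}|lborel. s ^ k * exp (- (c * s))) = fact k / c ^ Suc k"
proof -
  let ?e = "erlang_density k c"
  have "(\<integral>\<^sup>+ s. ennreal (?e s) \<partial>lborel) = ennreal 1"
    using nn_integral_erlang_ith_moment[OF c, of k 0] by simp
  then have "has_bochner_integral lborel ?e 1"
    by (intro has_bochner_integral_nn_integral) (use c in auto)
  then have "has_bochner_integral lborel (\<lambda>s. fact k / c ^ Suc k * ?e s) (fact k / c ^ Suc k * 1)"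
    by (rule has_bochner_integral_mult_right)
  moreover have "(\<lambda>s. fact k / c ^ Suc k * ?e s) = (\<lambda>s. indicator {0..} s *\<^sub>R (s ^ k * exp (- (c * s))))"
    using c by (auto simp: erlang_density_def indicator_def fun_eq_iff)
  ultimately have "has_bochner_integral lborel (\<lambda>s. indicator {0..} s *\<^sub>R (s ^ k * exp (- (c * s)))) (fact k / c ^ Suc k)"
    by simp
  then show "set_integrable lborel {0..} (\<lambda>s. s ^ k * exp (- (c * s)))"
    and "(LINT s:{0..}|lborel. s ^ k * exp (- (c * s))) = fact k / c ^ Suc k"
    by (auto simp: set_integrable_def set_lebesgue_integral_def has_bochner_integral_iff)
qed

lemma set_integrable_power_shifted_gaussian:
  fixes x :: real
  assumes x: "x > 0"
  shows "set_integrable lborel {0..} (\<lambda>s. s ^ k * exp (- (x + s)\<^sup>2))"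
proof (rule set_integrable_bound[OF power_exp_integral(1)[of "2 * x" k]])
  show "2 * x > 0" using x by simp
  show "set_borel_measurable lborel {0..} (\<lambda>s. s ^ k * exp (- (x + s)\<^sup>2))"
    by (auto simp: set_borel_measurable_def)
  show "AE s in lborel. s \<in> {0..} \<longrightarrow> norm (s ^ k * exp (- (x + s)\<^sup>2)) \<le> norm (s ^ k * exp (- (2 * x * s)))"
    using x by (intro AE_I2) (auto simp: abs_mult power2_eq_square algebra_simps intro!: mult_left_mono)
qed

lemma shifted_gaussian_tendsto_0:
  fixes x :: real
  assumes x: "x > 0"
  shows "((\<lambda>s. s ^ k * exp (- (x + s)\<^sup>2)) \<longlongrightarrow> 0) at_top"
proof (rule Lim_null_comparison)
  show "eventually (\<lambda>s. norm (s ^ k * exp (- (x + s)\<^sup>2)) \<le> s ^ k / exp s) at_top"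
    using eventually_ge_at_top[of 1]
  proof eventually_elim
    case (elim s)
    have "s * 1 \<le> s * s" using elim by (intro mult_left_mono) auto
    also have "\<dots> \<le> (x + s)\<^sup>2" using x elim by (simp add: power2_eq_square algebra_simps)
    finally have "exp (- (x + s)\<^sup>2) \<le> exp (- s)" by simp
    then show ?case using elim by (simp add: abs_mult exp_minus field_simps mult_left_mono)
  qed
  show "((\<lambda>s::real. s ^ k / exp s) \<longlongrightarrow> 0) at_top" by (rule tendsto_power_div_exp_0)
qed

text \<open>The integrand is the derivative of \<open>s ^ k * exp (- (x + s)\<^sup>2)\<close>; this
  is the integration by parts behind the three-term recurrence. The right-hand side is the boundary
  value at \<open>s = 0\<close>, nonzero only for \<open>k = 0\<close>. In that case the truncated
  exponent \<open>k - 1\<close> is harmless because of the factor \<open>real k\<close>.\<close>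

lemma shifted_gaussian_FTC:
  fixes x :: real
  assumes x: "x > 0"
  shows "(LINT s:{0..}|lborel. real k * s ^ (k - 1) * exp (- (x + s)\<^sup>2) - 2 * (x + s) * (s ^ k * exp (- (x + s)\<^sup>2)))
    = - (0 ^ k * exp (- x\<^sup>2))"
proof -
  let ?F = "\<lambda>s::real. s ^ k * exp (- (x + s)\<^sup>2)"
  let ?f = "\<lambda>s::real. real k * s ^ (k - 1) * exp (- (x + s)\<^sup>2) - 2 * (x + s) * (s ^ k * exp (- (x + s)\<^sup>2))"
  have feq: "?f = (\<lambda>s. real k * (s ^ (k - 1) * exp (- (x + s)\<^sup>2)) - (2 * x) * (s ^ k * exp (- (x + s)\<^sup>2))
      - 2 * (s ^ Suc k * exp (- (x + s)\<^sup>2)))"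
    by (rule ext) (simp add: algebra_simps)
  have int: "set_integrable lborel {0..} ?f"
    unfolding feq
    by (intro set_integral_diff set_integrable_mult_right set_integrable_power_shifted_gaussian[OF x])
  have e: "einterval 0 \<infinity> = {0<..}" by (auto simp: einterval_def)
  have DF: "(?F has_real_derivative ?f s) (at s)" for s
    by (auto intro!: derivative_eq_intros simp: algebra_simps)
  have "(LBINT s=0..\<infinity>. ?f s) = 0 - 0 ^ k * exp (- (x + 0)\<^sup>2)"
  proof (rule interval_integral_FTC_integrable)
    show "(?F has_vector_derivative ?f s) (at s)" for s
      using DF by (simp add: has_real_derivative_iff_has_vector_derivative)
    show "isCont ?f s" for s by (intro continuous_intros)
    show "set_integrable lborel (einterval 0 \<infinity>) ?f"
      unfolding e by (rule set_integrable_subset[OF int]) auto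
    have "(?F \<longlongrightarrow> ?F 0) (at_right 0)" by (intro tendsto_intros)
    then show "((?F \<circ> real_of_ereal) \<longlongrightarrow> 0 ^ k * exp (- (x + 0)\<^sup>2)) (at_right 0)"
      unfolding zero_ereal_def ereal_tendsto_simps by simp
    show "((?F \<circ> real_of_ereal) \<longlongrightarrow> 0) (at_left \<infinity>)"
      unfolding ereal_tendsto_simps by (rule shifted_gaussian_tendsto_0[OF x])
  qed auto
  moreover have "(LBINT s=0..\<infinity>. ?f s) = (LINT s:{0..}|lborel. ?f s)"
  proof -
    have "(LBINT s=0..\<infinity>. ?f s) = (LINT s:{0<..}|lborel. ?f s)"
      by (simp add: interval_lebesgue_integral_def e)
    also have "\<dots> = (LINT s:{0..}|lborel. ?f s)"
      unfolding set_lebesgue_integral_def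
      by (rule integral_discrete_difference[of "{0}"]) (auto simp: indicator_def)
    finally show ?thesis .
  qed
  ultimately show ?thesis by simp
qed

text \<open>The moments \<open>J k\<close> satisfy a recurrence with coefficients
  \<open>real k\<close> and \<open>2\<close>; dividing by \<open>fact k\<close> converts it into the
  one that defines \<open>ierfc\<close>.\<close>

lemma ierfc_eq_integral:
  fixes x :: real
  assumes x: "x > 0"
  shows "ierfc (Suc k) x = (LINT s:{0..}|lborel. s ^ k * exp (- (x + s)\<^sup>2)) / fact k"
proof -
  define J where "J = (\<lambda>k. LINT s:{0..}|lborel. s ^ k * exp (- (x + s)\<^sup>2))"
  have rec: "real k * J (k - 1) - (2 * x) * J k - 2 * J (Suc k) = - (0 ^ k * exp (- x\<^sup>2))" for k
  proof -
    have "(LINT s:{0..}|lborel. real k * s ^ (k - 1) * exp (- (x + s)\<^sup>2) - 2 * (x + s) * (s ^ k * exp (- (x + s)\<^sup>2)))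
     = (LINT s:{0..}|lborel. (real k * (s ^ (k - 1) * exp (- (x + s)\<^sup>2)) - (2 * x) * (s ^ k * exp (- (x + s)\<^sup>2)))
      - 2 * (s ^ Suc k * exp (- (x + s)\<^sup>2)))"
      by (rule arg_cong[where f = "set_lebesgue_integral lborel {0..}"]) (auto simp: algebra_simps)
    also have "\<dots> = real k * J (k - 1) - (2 * x) * J k - 2 * J (Suc k)"
      unfolding J_def
      by (simp only: set_integral_diff(2) set_integral_diff(1) set_integrable_mult_right
           set_integrable_power_shifted_gaussian[OF x] set_integral_mult_right)
    finally show ?thesis using shifted_gaussian_FTC[OF x, of k] by simp
  qed
  have "erfc x = 2 / sqrt pi * J 0"
  proof -
    have "(LBINT t:{x..}. exp (- t\<^sup>2)) = (LINT t|lborel. indicator {x..} t *\<^sub>R exp (- t\<^sup>2))"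
      by (simp add: set_lebesgue_integral_def)
    also have "\<dots> = \<bar>1\<bar> *\<^sub>R (LINT s|lborel. indicator {x..} (x + 1 * s) *\<^sub>R exp (- (x + 1 * s)\<^sup>2))"
      by (rule lborel_integral_real_affine) simp
    also have "\<dots> = J 0"
      unfolding J_def set_lebesgue_integral_def by (simp add: indicator_def)
    finally show ?thesis by (simp add: erfc_def)
  qed
  then have b: "ierfc (Suc 0) x = J 0" by simp
  have "ierfc (Suc k) x = J k / fact k"
  proof (induction k rule: less_induct)
    case (less k)
    show ?case
    proof (cases k)
      case 0
      then show ?thesis using b by simp
    next
      case (Suc l)
      have IH: "ierfc (Suc l) x = J l / fact l" using less Suc by simp
      have J: "J (Suc l) = (real l * J (l - 1) + 0 ^ l * exp (- x\<^sup>2) - 2 * x * J l) / 2"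
        using rec[of l] by simp
      show ?thesis
      proof (cases l)
        \<comment> \<open>Here the recurrence reaches down to \<open>ierfc 0\<close>, which is not
          one of the moments; the boundary term \<open>0 ^ 0 * exp (- x\<^sup>2)\<close> takes its
          place.\<close>
        case 0
        then show ?thesis using Suc b J by (simp del: ierfc.simps(2))
      next
        case (Suc j)
        have "ierfc (Suc j) x = J j / fact j" using less Suc \<open>k = Suc l\<close> by simp
        moreover have gen: "(a / f - 2 * x * (b / f)) / (2 * c) = (a - 2 * x * b) / (2 * (c * f))" for a b c f :: real
          by (simp add: diff_divide_distrib mult_ac)
        ultimately have "ierfc (Suc k) x = (J j / fact j - 2 * x * (J (Suc j) / fact (Suc j))) / (2 * real (Suc (Suc j)))"
          using IH unfolding \<open>k = Suc l\<close> Suc ierfc.simps(3)[of "Suc j"] by (simp only:)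
        also have "J j / fact j = real (Suc j) * J j / fact (Suc j)" by simp
        also have "(real (Suc j) * J j / fact (Suc j) - 2 * x * (J (Suc j) / fact (Suc j))) / (2 * real (Suc (Suc j)))
            = (real (Suc j) * J j - 2 * x * J (Suc j)) / (2 * (real (Suc (Suc j)) * fact (Suc j)))"
          by (rule gen)
        also have "real (Suc j) * J j - 2 * x * J (Suc j) = 2 * J k"
          using J unfolding \<open>k = Suc l\<close> Suc by simp
        also have "real (Suc (Suc j)) * fact (Suc j) = fact k"
          unfolding \<open>k = Suc l\<close> Suc by simp
        finally show ?thesis by simp
      qed
    qed
  qed
  then show ?thesis by (simp add: J_def)
qed

text \<open>In Lagrange's form the remainder is evaluated at a negative point \<open>t\<close>,
  where \<open>exp t \<le> 1\<close>. The resulting bound is a pure power of \<open>u\<close>, which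
  can be integrated against the exponential weight.\<close>

lemma exp_minus_Taylor_bound:
  fixes u :: real
  assumes "u \<ge> 0"
  shows "\<bar>exp (- u) - (\<Sum>j\<le>K. (- u) ^ j / fact j)\<bar> \<le> u ^ Suc K / fact (Suc K)"
proof (cases "u = 0")
  case False
  then obtain t where t: "- u < t" "t < 0"
    "exp (- u) = (\<Sum>m<Suc K. exp 0 / fact m * (- u) ^ m) + exp t / fact (Suc K) * (- u) ^ Suc K"
    using Maclaurin_minus[of "- u" "Suc K" "\<lambda>_. exp" exp] assms by auto
  have "\<bar>exp t / fact (Suc K) * (- u) ^ Suc K\<bar> = exp t * (u ^ Suc K / fact (Suc K))"
    using assms by (simp only: abs_mult abs_divide power_abs abs_minus_cancel abs_of_nonneg[OF fact_ge_zero]) simp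
  also have "\<dots> \<le> u ^ Suc K / fact (Suc K)"
    using t assms by (intro mult_left_le_one_le) auto
  finally show ?thesis using t by (simp add: lessThan_Suc_atMost)
next
  case True
  then have "(\<Sum>j\<le>K. (- u) ^ j / fact j) = (\<Sum>j\<le>K. if j = 0 then 1 else 0)"
    by (intro sum.cong) auto
  with True show ?thesis by simp
qed

lemma set_integral_sum:
  fixes f :: "'i \<Rightarrow> 'a \<Rightarrow> 'b::{banach, second_countable_topology}"
  assumes "\<And>i. i \<in> I \<Longrightarrow> set_integrable M A (f i)"
  shows "set_integrable M A (\<lambda>x. \<Sum>i\<in>I. f i x)"
    and "(LINT x:A|M. (\<Sum>i\<in>I. f i x)) = (\<Sum>i\<in>I. LINT x:A|M. f i x)"
  using assms unfolding set_integrable_def set_lebesgue_integral_def scaleR_sum_right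
  by (rule Bochner_Integration.integrable_sum Bochner_Integration.integral_sum; simp)+

text \<open>After \<open>exp (- x\<^sup>2)\<close> is split off, the weight is
  \<open>s ^ k * exp (- (2 * x * s))\<close>, and every Taylor term of
  \<open>exp (- s\<^sup>2)\<close> gives a Gamma integral. The weight is nonnegative, so the bound
  on the Taylor remainder integrates to the size of the first omitted term, for every
  \<open>x > 0\<close> and every \<open>K\<close>.\<close>

lemma ierfc_asymptotic:
  fixes x :: real
  assumes x: "x > 0"
  shows "\<bar>exp (x\<^sup>2) * ierfc (Suc k) x - (\<Sum>j\<le>K. (- 1) ^ j * fact (k + 2 * j) / (fact j * fact k * (2 * x) ^ Suc (k + 2 * j)))\<bar>
    \<le> fact (k + 2 * Suc K) / (fact (Suc K) * fact k * (2 * x) ^ Suc (k + 2 * Suc K))"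
proof -
  have x2: "2 * x > 0" using x by simp
  note E = power_exp_integral[OF x2]
  define g where "g = (\<lambda>j s. s ^ (k + 2 * j) * exp (- (2 * x * s)) :: real)"
  define r where "r = (\<lambda>s. s ^ k * exp (- (x + s)\<^sup>2) * exp (x\<^sup>2) - (\<Sum>j\<le>K. (- 1) ^ j / fact j * g j s))"
  have gi: "set_integrable lborel {0..} (g j)" for j unfolding g_def by (rule E(1))
  have gv: "(LINT s:{0..}|lborel. g j s) = fact (k + 2 * j) / (2 * x) ^ Suc (k + 2 * j)" for j
    unfolding g_def by (rule E(2))
  have si: "set_integrable lborel {0..} (\<lambda>s. \<Sum>j\<le>K. (- 1) ^ j / fact j * g j s)"
    by (intro set_integral_sum(1) set_integrable_mult_right gi)
  have fi: "set_integrable lborel {0..} (\<lambda>s. s ^ k * exp (- (x + s)\<^sup>2) * exp (x\<^sup>2))"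
    by (intro set_integrable_mult_left set_integrable_power_shifted_gaussian[OF x])
  have ri: "set_integrable lborel {0..} r" unfolding r_def by (intro set_integral_diff fi si)
  have rv: "(LINT s:{0..}|lborel. r s) / fact k = exp (x\<^sup>2) * ierfc (Suc k) x -
      (\<Sum>j\<le>K. (- 1) ^ j * fact (k + 2 * j) / (fact j * fact k * (2 * x) ^ Suc (k + 2 * j)))"
  proof -
    have "(LINT s:{0..}|lborel. r s) = (LINT s:{0..}|lborel. s ^ k * exp (- (x + s)\<^sup>2) * exp (x\<^sup>2))
        - (LINT s:{0..}|lborel. \<Sum>j\<le>K. (- 1) ^ j / fact j * g j s)"
      unfolding r_def by (rule set_integral_diff(2)[OF fi si])
    also have "(LINT s:{0..}|lborel. s ^ k * exp (- (x + s)\<^sup>2) * exp (x\<^sup>2)) = exp (x\<^sup>2) * ierfc (Suc k) x * fact k"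
      using ierfc_eq_integral[OF x, of k] by (simp add: set_integral_mult_left del: ierfc.simps)
    also have "(LINT s:{0..}|lborel. \<Sum>j\<le>K. (- 1) ^ j / fact j * g j s)
       = (\<Sum>j\<le>K. LINT s:{0..}|lborel. (- 1) ^ j / fact j * g j s)"
      by (intro set_integral_sum(2) set_integrable_mult_right gi)
    also have "\<dots> = (\<Sum>j\<le>K. (- 1) ^ j / fact j * (fact (k + 2 * j) / (2 * x) ^ Suc (k + 2 * j)))"
      by (simp only: set_integral_mult_right gv)
    finally have "(LINT s:{0..}|lborel. r s) / fact k = exp (x\<^sup>2) * ierfc (Suc k) x
        - (\<Sum>j\<le>K. (- 1) ^ j / fact j * (fact (k + 2 * j) / (2 * x) ^ Suc (k + 2 * j))) / fact k"
      by (simp only: diff_divide_distrib) simp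
    also have "(\<Sum>j\<le>K. (- 1) ^ j / fact j * (fact (k + 2 * j) / (2 * x) ^ Suc (k + 2 * j))) / fact k =
        (\<Sum>j\<le>K. (- 1) ^ j * fact (k + 2 * j) / (fact j * fact k * (2 * x) ^ Suc (k + 2 * j)))"
      unfolding sum_divide_distrib by (rule sum.cong) (simp_all add: mult_ac)
    finally show ?thesis .
  qed
  have "\<bar>LINT s:{0..}|lborel. r s\<bar> \<le> (LINT s:{0..}|lborel. \<bar>r s\<bar>)"
    using set_integral_norm_bound[OF ri] by simp
  also have "\<dots> \<le> (LINT s:{0..}|lborel. 1 / fact (Suc K) * g (Suc K) s)"
  proof (rule set_integral_mono)
    show "set_integrable lborel {0..} (\<lambda>s. \<bar>r s\<bar>)" using set_integrable_abs[OF ri] .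
    show "set_integrable lborel {0..} (\<lambda>s. 1 / fact (Suc K) * g (Suc K) s)"
      using gi by (intro set_integrable_mult_right)
    fix s :: real assume s: "s \<in> {0..}"
    have "exp (- (x + s)\<^sup>2) * exp (x\<^sup>2) = exp (- (2 * x * s)) * exp (- s\<^sup>2)"
      by (simp add: exp_add[symmetric] power2_eq_square algebra_simps)
    then have "r s = s ^ k * exp (- (2 * x * s)) * (exp (- s\<^sup>2) - (\<Sum>j\<le>K. (- s\<^sup>2) ^ j / fact j))"
      unfolding r_def g_def power_add power_mult power_minus[of "s\<^sup>2"]
      by (simp add: sum_distrib_left right_diff_distrib mult_ac)
    then have "\<bar>r s\<bar> = s ^ k * exp (- (2 * x * s)) * \<bar>exp (- s\<^sup>2) - (\<Sum>j\<le>K. (- s\<^sup>2) ^ j / fact j)\<bar>"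
      using s by (simp only: abs_mult) simp
    also have "\<dots> \<le> s ^ k * exp (- (2 * x * s)) * ((s\<^sup>2) ^ Suc K / fact (Suc K))"
      using s by (intro mult_left_mono exp_minus_Taylor_bound) auto
    also have "\<dots> = 1 / fact (Suc K) * g (Suc K) s"
      unfolding g_def power_add power_mult by simp
    finally show "\<bar>r s\<bar> \<le> 1 / fact (Suc K) * g (Suc K) s" .
  qed
  also have "\<dots> = 1 / fact (Suc K) * (fact (k + 2 * Suc K) / (2 * x) ^ Suc (k + 2 * Suc K))"
    by (simp only: set_integral_mult_right gv)
  finally have "\<bar>(LINT s:{0..}|lborel. r s) / fact k\<bar> \<le>
      1 / fact (Suc K) * (fact (k + 2 * Suc K) / (2 * x) ^ Suc (k + 2 * Suc K)) / fact k"
    unfolding abs_divide abs_of_nonneg[OF fact_ge_zero, of k] by (rule divide_right_mono) simp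
  moreover have "1 / a * (b / c) / d = b / (a * d * c)" for a b c d :: real by simp
  ultimately show ?thesis unfolding rv by (simp only:)
qed

text \<open>The estimate \<open>exp (- s\<^sup>2) \<le> 1\<close> leaves a Gamma integral. The
  Gaussian factor that remains is what makes the sum over the modes converge.\<close>

lemma ierfc_bounds:
  fixes x :: real
  assumes x: "x > 0"
  shows "0 \<le> ierfc (Suc k) x" and "ierfc (Suc k) x \<le> exp (- x\<^sup>2) / (2 * x) ^ Suc k"
proof -
  have x2: "2 * x > 0" using x by simp
  show "0 \<le> ierfc (Suc k) x"
    unfolding ierfc_eq_integral[OF x] set_lebesgue_integral_def
    by (intro divide_nonneg_pos integral_nonneg_AE AE_I2) (auto simp: indicator_def)
  have "(LINT s:{0..}|lborel. s ^ k * exp (- (x + s)\<^sup>2)) \<le> (LINT s:{0..}|lborel. exp (- x\<^sup>2) * (s ^ k * exp (- (2 * x * s))))"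
  proof (rule set_integral_mono)
    show "set_integrable lborel {0..} (\<lambda>s. exp (- x\<^sup>2) * (s ^ k * exp (- (2 * x * s))))"
      by (intro set_integrable_mult_right power_exp_integral(1)[OF x2])
    fix s :: real assume s: "s \<in> {0..}"
    have "exp (- (x + s)\<^sup>2) \<le> exp (- x\<^sup>2) * exp (- (2 * x * s))"
      by (simp add: exp_add[symmetric] power2_eq_square algebra_simps)
    then show "s ^ k * exp (- (x + s)\<^sup>2) \<le> exp (- x\<^sup>2) * (s ^ k * exp (- (2 * x * s)))"
      using s by (simp add: mult.left_commute mult_left_mono)
  qed (rule set_integrable_power_shifted_gaussian[OF x])
  also have "\<dots> = exp (- x\<^sup>2) * (fact k / (2 * x) ^ Suc k)"
    by (simp only: set_integral_mult_right power_exp_integral(2)[OF x2])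
  finally have "(LINT s:{0..}|lborel. s ^ k * exp (- (x + s)\<^sup>2)) / fact k
      \<le> exp (- x\<^sup>2) * (fact k / (2 * x) ^ Suc k) / fact k"
    by (rule divide_right_mono) simp
  also have "\<dots> = exp (- x\<^sup>2) / (2 * x) ^ Suc k" by (simp del: power_Suc)
  finally show "ierfc (Suc k) x \<le> exp (- x\<^sup>2) / (2 * x) ^ Suc k"
    unfolding ierfc_eq_integral[OF x] .
qed

section \<open>Values of the zeta function\<close>

text \<open>The error of the trapezoidal rule for the integral of \<open>x powr (- z)\<close> over \<open>[n + 1, n + 2]\<close>. It is of second
  order, so summing it continues the zeta function to \<open>Re z > - 1\<close>; it vanishes at \<open>z = 0\<close>.\<close>

definition zeta_trapezoid_term :: "nat \<Rightarrow> complex \<Rightarrow> complex" where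
  "zeta_trapezoid_term n z = (of_nat (Suc n) powr (- z) + of_nat (Suc (Suc n)) powr (- z)) / 2
     - (of_nat (Suc (Suc n)) powr (1 - z) - of_nat (Suc n) powr (1 - z)) / (1 - z)"

text \<open>The error is regarded as a function \<open>E\<close> of the step length
  \<open>w\<close>. Both \<open>E\<close> and its derivative \<open>G\<close> vanish at
  \<open>w = 0\<close>, so a bound on the second derivative \<open>G'\<close> passes to
  \<open>E\<close> by two mean value estimates. Restricting to \<open>Re z > - 1 / 2\<close> makes
  the exponent \<open>- 3 / 2\<close> independent of \<open>z\<close> while the series over
  \<open>a\<close> still converges.\<close>

lemma trapezoid_error_bound:
  fixes a :: real and z :: complex
  assumes a: "a \<ge> 1" and z: "Re z > - 1 / 2" "z \<noteq> 1"
  shows "norm ((of_real a powr (- z) + (of_real a + 1) powr (- z)) / 2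
     - ((of_real a + 1) powr (1 - z) - of_real a powr (1 - z)) / (1 - z))
     \<le> norm z * norm (z + 1) * a powr (- 3 / 2)"
proof -
  let ?S = "closed_segment (0::complex) 1"
  define b where "b = complex_of_real a"
  define B where "B = norm z * norm (z + 1) * a powr (- 3 / 2)"
  define E where "E = (\<lambda>w. w * (b powr (- z) + (b + w) powr (- z)) / 2 - ((b + w) powr (1 - z) - b powr (1 - z)) / (1 - z))"
  define G where "G = (\<lambda>w. (b powr (- z) - (b + w) powr (- z) + w * (- z * (b + w) powr (- z - 1))) / 2)"
  \<comment> \<open>In the derivative of \<open>G\<close> the two terms with
    \<open>(b + w) powr (- z - 1)\<close> cancel; two differentiations of the power produce the
    factor \<open>z * (z + 1)\<close>.\<close>
  define G' where "G' = (\<lambda>w. w * (z * (z + 1) * (b + w) powr (- z - 2)) / 2)"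
  have S: "\<exists>u. w = of_real u \<and> 0 \<le> u \<and> u \<le> 1" if "w \<in> ?S" for w
    using that by (auto simp: closed_segment_def scaleR_conv_of_real)
  have nz: "b + w \<notin> \<real>\<^sub>\<le>\<^sub>0" "b + w \<noteq> 0" if "w \<in> ?S" for w
    using S[OF that] a by (auto simp: b_def complex_nonpos_Reals_iff complex_eq_iff)
  have nw: "norm w \<le> 1" if "w \<in> ?S" for w
    using S[OF that] by auto
  have D: "((\<lambda>w. (b + w) powr r) has_field_derivative r * (b + w) powr (r - 1)) (at w within ?S)" if "w \<in> ?S" for w r
    using nz[OF that] by (auto intro!: derivative_eq_intros)
  have dE: "(E has_field_derivative G w) (at w within ?S)" if "w \<in> ?S" for w
  proof -
    have "(E has_field_derivative ((1 * (b powr (- z) + (b + w) powr (- z)) + (0 + - z * (b + w) powr (- z - 1)) * w) / 2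
        - ((1 - z) * (b + w) powr (1 - z - 1) - 0) / (1 - z))) (at w within ?S)"
      unfolding E_def
      by (intro DERIV_diff DERIV_cdivide DERIV_mult DERIV_ident DERIV_add DERIV_const D[OF that])
    moreover have "(1 * (b powr (- z) + (b + w) powr (- z)) + (0 + - z * (b + w) powr (- z - 1)) * w) / 2
        - ((1 - z) * (b + w) powr (1 - z - 1) - 0) / (1 - z) = G w"
      unfolding G_def using z by (simp add: diff_divide_distrib add_divide_distrib mult_ac)
    ultimately show ?thesis by (simp only:)
  qed
  have dG: "(G has_field_derivative G' w) (at w within ?S)" if "w \<in> ?S" for w
  proof -
    have e: "- z - 1 - 1 = - z - 2" by simp
    have "(G has_field_derivative (0 - - z * (b + w) powr (- z - 1) + (1 * (- z * (b + w) powr (- z - 1))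
        + (- z * ((- z - 1) * (b + w) powr (- z - 1 - 1))) * w)) / 2) (at w within ?S)"
      unfolding G_def
      by (intro DERIV_diff DERIV_cdivide DERIV_mult DERIV_ident DERIV_cmult DERIV_add DERIV_const D[OF that])
    then show ?thesis unfolding G'_def e by (simp add: algebra_simps)
  qed
  have bG': "norm (G' w) \<le> B" if w: "w \<in> ?S" for w
  proof -
    from S[OF w] obtain u where u: "w = of_real u" "0 \<le> u" "u \<le> 1" by blast
    have "norm ((b + w) powr (- z - 2)) = (a + u) powr (- Re z - 2)"
      unfolding b_def u of_real_add[symmetric] using a u by (subst norm_powr_real_powr) auto
    also have "\<dots> \<le> a powr (- Re z - 2)"
      using a u z by (intro powr_mono2') auto
    also have "\<dots> \<le> a powr (- 3 / 2)"
    proof (rule powr_mono)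
      have "- (3 / 2) - (- Re z - 2) = Re z + 1 / 2" by simp
      then show "- Re z - 2 \<le> - 3 / 2" using z(1) by argo
    qed (use a in simp)
    finally have p: "norm ((b + w) powr (- z - 2)) \<le> a powr (- 3 / 2)" .
    have "norm (G' w) = norm w * (norm z * norm (z + 1) * norm ((b + w) powr (- z - 2))) / 2"
      by (simp add: G'_def norm_mult norm_divide)
    also have "\<dots> \<le> 1 * (norm z * norm (z + 1) * a powr (- 3 / 2)) / 1"
      using nw[OF w] p by (intro frac_le mult_mono) auto
    finally show ?thesis by (simp add: B_def)
  qed
  have B0: "B \<ge> 0" by (simp add: B_def)
  have bG: "norm (G w) \<le> B" if w: "w \<in> ?S" for w
  proof -
    have "norm (G w - G 0) \<le> B * norm (w - 0)"
      by (rule field_differentiable_bound[OF convex_closed_segment dG bG' w]) auto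
    also have "\<dots> \<le> B * 1" using nw[OF w] B0 by (intro mult_left_mono) auto
    finally show ?thesis by (simp add: G_def)
  qed
  have "norm (E 1 - E 0) \<le> B * norm (1 - 0 :: complex)"
    by (rule field_differentiable_bound[OF convex_closed_segment dE bG]) auto
  then show ?thesis by (simp add: E_def B_def b_def)
qed

lemma zeta_trapezoid_term_bound:
  assumes "Re z > - 1 / 2" "z \<noteq> 1"
  shows "norm (zeta_trapezoid_term n z) \<le> norm z * norm (z + 1) * real (Suc n) powr (- 3 / 2)"
  using trapezoid_error_bound[of "real (Suc n)" z] assms
  by (simp add: zeta_trapezoid_term_def add_ac)

lemma summable_Suc_powr: "summable (\<lambda>n. real (Suc n) powr (- 3 / 2))"
  using summable_real_powr_iff[of "- 3 / 2"] by (subst summable_Suc_iff) simp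

text \<open>In the sum of the trapezoids every interior node is counted twice with weight one half,
  which leaves half of each end term, and the integrals telescope. For \<open>Re z > 1\<close> the
  contributions of the far end vanish; the near end leaves \<open>1 / 2\<close> and
  \<open>1 / (z - 1)\<close>.\<close>

lemma zeta_trapezoid_sums:
  assumes z: "Re z > 1"
  shows "(\<lambda>n. 1 / of_nat (Suc n) powr z) sums (1 / (z - 1) + 1 / 2 + (\<Sum>n. zeta_trapezoid_term n z))"
proof -
  have z1: "z \<noteq> 1" "z \<noteq> 0" using z by auto
  have "summable (\<lambda>n. zeta_trapezoid_term n z)"
    by (rule summable_comparison_test'[OF summable_mult[OF summable_Suc_powr], of 0 _ "norm z * norm (z + 1)"])
       (use zeta_trapezoid_term_bound z z1 in auto)
  then have t: "(\<lambda>N. \<Sum>n<N. zeta_trapezoid_term n z) \<longlonglongrightarrow> (\<Sum>n. zeta_trapezoid_term n z)"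
    by (rule summable_LIMSEQ)
  have lim0: "(\<lambda>N. of_nat (Suc N) powr (- w)) \<longlonglongrightarrow> (0::complex)" if "Re w > 0" for w
  proof (rule tendsto_norm_zero_cancel)
    have "(\<lambda>N. real (Suc N) powr (- Re w)) \<longlonglongrightarrow> 0"
      using that by (intro tendsto_neg_powr filterlim_compose[OF filterlim_real_sequentially filterlim_Suc]) auto
    moreover have "norm (of_nat (Suc N) powr (- w) :: complex) = real (Suc N) powr (- Re w)" for N
      by (subst norm_powr_real_powr) auto
    ultimately show "(\<lambda>N. norm (of_nat (Suc N) powr (- w) :: complex)) \<longlonglongrightarrow> 0" by simp
  qed
  have part: "(\<Sum>n<N. 1 / of_nat (Suc n) powr z) = (\<Sum>n<N. zeta_trapezoid_term n z) + 1 / 2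
      - of_nat (Suc N) powr (- z) / 2 + (of_nat (Suc N) powr (- (z - 1)) - 1) / (1 - z)" for N
  proof (induction N)
    case (Suc N)
    define A B C D :: complex where "A = of_nat (Suc N) powr (- z)" and "B = of_nat (Suc (Suc N)) powr (- z)"
      and "C = of_nat (Suc N) powr (1 - z)" and "D = of_nat (Suc (Suc N)) powr (1 - z)"
    have "1 / of_nat (Suc N) powr z = A" by (simp add: A_def powr_minus_divide)
    then show ?case
      using Suc by (simp add: zeta_trapezoid_term_def A_def[symmetric] B_def[symmetric] C_def[symmetric]
          D_def[symmetric] del: of_nat_Suc) (simp add: diff_divide_distrib add_divide_distrib)
  qed (simp add: powr_def)
  have "(\<lambda>N. (\<Sum>n<N. zeta_trapezoid_term n z) + 1 / 2 - of_nat (Suc N) powr (- z) / 2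
      + (of_nat (Suc N) powr (- (z - 1)) - 1) / (1 - z)) \<longlonglongrightarrow> (\<Sum>n. zeta_trapezoid_term n z) + 1 / 2 - 0 / 2 + (0 - 1) / (1 - z)"
    using z by (intro tendsto_intros t lim0) (use z1 in auto)
  moreover have "(\<Sum>n. zeta_trapezoid_term n z) + 1 / 2 - 0 / 2 + (0 - 1) / (1 - z) =
      1 / (z - 1) + 1 / 2 + (\<Sum>n. zeta_trapezoid_term n z)"
  proof -
    have "(0 - 1) / (1 - z) = 1 / (z - 1)" using z1 by (simp add: field_simps)
    then show ?thesis by (simp only:) simp
  qed
  ultimately show ?thesis unfolding sums_def part by (simp only:)
qed

lemma zeta_continuation_trapezoid:
  "zeta_continuation (- 1 / 2) (\<lambda>z. 1 / (z - 1) + 1 / 2 + (\<Sum>n. zeta_trapezoid_term n z))"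
proof -
  let ?A = "{z. - 1 / 2 < Re z} - {1::complex}"
  have oA: "open ?A" by (intro open_delete open_halfspace_Re_gt)
  have ht: "zeta_trapezoid_term n holomorphic_on ?A" for n
    unfolding zeta_trapezoid_term_def by (intro holomorphic_intros) auto
  have "(\<lambda>z. \<Sum>n. zeta_trapezoid_term n z) holomorphic_on ?A"
  proof (rule holomorphic_uniform_sequence[OF oA])
    show "(\<lambda>z. \<Sum>n<N. zeta_trapezoid_term n z) holomorphic_on ?A" for N
      by (intro holomorphic_intros ht)
    fix x assume "x \<in> ?A"
    then obtain d where d: "d > 0" "cball x d \<subseteq> ?A" using oA open_contains_cball by blast
    \<comment> \<open>On the ball \<open>norm z\<close> is at most this radius, so the bound for a
      single term becomes uniform in \<open>z\<close>.\<close>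
    let ?R = "norm x + d"
    have "uniform_limit (cball x d) (\<lambda>N z. \<Sum>n<N. zeta_trapezoid_term n z) (\<lambda>z. \<Sum>n. zeta_trapezoid_term n z) sequentially"
    proof (rule Weierstrass_m_test[OF _ summable_mult[OF summable_Suc_powr, of "?R * (?R + 1)"]])
      fix n z assume z: "z \<in> cball x d"
      have "norm z \<le> ?R" using z norm_triangle_ineq4[of x "x - z"] by (simp add: dist_norm)
      moreover from this have "norm (z + 1) \<le> ?R + 1" using norm_triangle_ineq[of z 1] by simp
      ultimately have "norm z * norm (z + 1) * real (Suc n) powr (- 3 / 2) \<le> ?R * (?R + 1) * real (Suc n) powr (- 3 / 2)"
        using d by (intro mult_mono) auto
      then show "norm (zeta_trapezoid_term n z) \<le> ?R * (?R + 1) * real (Suc n) powr (- 3 / 2)"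
        using z d(2) by (intro order_trans[OF zeta_trapezoid_term_bound]) auto
    qed
    then show "\<exists>d>0. cball x d \<subseteq> ?A \<and>
        uniform_limit (cball x d) (\<lambda>N z. \<Sum>n<N. zeta_trapezoid_term n z) (\<lambda>z. \<Sum>n. zeta_trapezoid_term n z) sequentially"
      using d by blast
  qed
  then have "(\<lambda>z. 1 / (z - 1) + 1 / 2 + (\<Sum>n. zeta_trapezoid_term n z)) holomorphic_on ?A"
    by (intro holomorphic_intros) auto
  then show ?thesis
    unfolding zeta_continuation_def using zeta_trapezoid_sums by simp
qed

lemma riemann_zeta_0: "riemann_zeta 0 = - 1 / 2"
proof -
  have "zeta_trapezoid_term n 0 = 0" for n
  proof -
    have "of_nat (Suc n) \<noteq> (0::complex)" "of_nat (Suc (Suc n)) \<noteq> (0::complex)"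
      by (simp_all only: of_nat_eq_0_iff)
    then show ?thesis unfolding zeta_trapezoid_term_def by simp
  qed
  then show ?thesis by (subst riemann_zeta_eqI[OF zeta_continuation_trapezoid]) auto
qed

lemma summable_inverse_Suc_power:
  assumes "k \<ge> 2"
  shows "summable (\<lambda>l. 1 / real (Suc l) ^ k)"
proof -
  have "summable (\<lambda>l. 1 / real l ^ k)"
    using inverse_power_summable[OF assms, where 'a = real] by (simp add: inverse_eq_divide)
  then show ?thesis by (subst summable_Suc_iff[where f = "\<lambda>l. 1 / real l ^ k"])
qed

lemma riemann_zeta_of_nat:
  assumes "n \<ge> 2"
  shows "riemann_zeta (of_nat n) = of_real (\<Sum>l. 1 / real (Suc l) ^ n)"
proof -
  let ?f = "\<lambda>z. 1 / (z - 1) + 1 / 2 + (\<Sum>n. zeta_trapezoid_term n z)"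
  have "n \<noteq> 1" using assms by simp
  then have ne: "of_nat n \<noteq> (1::complex)" by (simp only: of_nat_eq_1_iff) simp
  have "(\<lambda>l. 1 / of_nat (Suc l) powr of_nat n) sums ?f (of_nat n)"
    using assms by (intro zeta_trapezoid_sums) simp
  then have "(\<lambda>l. complex_of_real (1 / real (Suc l) ^ n)) sums ?f (of_nat n)"
    by (simp add: powr_nat del: of_nat_Suc)
  moreover have "(\<lambda>l. complex_of_real (1 / real (Suc l) ^ n)) sums of_real (\<Sum>l. 1 / real (Suc l) ^ n)"
    by (intro sums_of_real summable_sums summable_inverse_Suc_power assms)
  ultimately have "?f (of_nat n) = of_real (\<Sum>l. 1 / real (Suc l) ^ n)" by (rule sums_unique2)
  then show ?thesis
    by (subst riemann_zeta_eqI[OF zeta_continuation_trapezoid]) (use ne in auto)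
qed

section \<open>The Hermite form of the iterated integrals\<close>

lemma hermite_0: "hermite 0 y = 1"
  by (simp add: hermite_def)

lemma deriv_hermite_generating:
  "deriv (\<lambda>t. exp (2 * y * t - t\<^sup>2)) = (\<lambda>t::complex. (2 * y - 2 * t) * exp (2 * y * t - t\<^sup>2))"
  by (rule ext, rule DERIV_imp_deriv) (auto intro!: derivative_eq_intros)

lemma hermite_1: "hermite (Suc 0) y = 2 * y"
  by (simp add: hermite_def deriv_hermite_generating)

text \<open>The derivative of the generating function is the generating function times a linear
  factor. In the Leibniz rule all derivatives of that factor beyond the first vanish, which leaves
  two terms.\<close>

lemma hermite_Suc_Suc:
  "hermite (Suc (Suc k)) y = 2 * y * hermite (Suc k) y - 2 * of_nat (Suc k) * hermite k y"
proof -
  let ?g = "\<lambda>t::complex. exp (2 * y * t - t\<^sup>2)" and ?l = "\<lambda>t::complex. 2 * y - 2 * t"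
  have dl: "deriv ?l = (\<lambda>t. - 2)"
    by (rule ext, rule DERIV_imp_deriv) (auto intro!: derivative_eq_intros)
  have "(deriv ^^ i) (\<lambda>t::complex. - 2 :: complex) = (\<lambda>t. if i = 0 then - 2 else 0)" for i
    by (induction i) (auto simp: fun_eq_iff)
  then have dli: "(deriv ^^ Suc i) ?l 0 = (if i = 0 then - 2 else 0)" for i
    by (simp only: funpow_Suc_right o_apply dl)
  have "hermite (Suc (Suc k)) y = (deriv ^^ Suc k) (\<lambda>t. ?l t * ?g t) 0"
    by (simp only: hermite_def funpow_Suc_right[of "Suc k"] o_apply deriv_hermite_generating)
  also have "\<dots> = (\<Sum>i = 0..Suc k. of_nat (Suc k choose i) * (deriv ^^ i) ?l 0 * (deriv ^^ (Suc k - i)) ?g 0)"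
    by (rule higher_deriv_mult[of _ UNIV]) (auto intro!: holomorphic_intros)
  also have "\<dots> = ?l 0 * (deriv ^^ Suc k) ?g 0
      + (\<Sum>i = 0..k. of_nat (Suc k choose Suc i) * (deriv ^^ Suc i) ?l 0 * (deriv ^^ (k - i)) ?g 0)"
    by (subst sum.atLeast0_atMost_Suc_shift) (simp del: funpow.simps binomial_Suc_Suc)
  also have "(\<Sum>i = 0..k. of_nat (Suc k choose Suc i) * (deriv ^^ Suc i) ?l 0 * (deriv ^^ (k - i)) ?g 0)
      = (\<Sum>i = 0..k. if i = 0 then of_nat (Suc k) * (- 2) * (deriv ^^ k) ?g 0 else 0)"
    unfolding dli by (intro sum.cong) auto
  also have "\<dots> = - 2 * of_nat (Suc k) * (deriv ^^ k) ?g 0" by simp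
  finally show ?thesis by (simp add: hermite_def algebra_simps del: funpow.simps)
qed

text \<open>\<open>gauss_part K\<close> is, up to sign, the polynomial part of the product of the Hermite factor with the divergent
  asymptotic series of \<open>erfc\<close>, whose coefficients are \<open>erfc_tail_coeff\<close>.\<close>

definition erfc_tail_coeff :: "nat \<Rightarrow> real" where
  "erfc_tail_coeff j = (- 1) ^ j * fact (2 * j) / (4 ^ j * fact j)"

definition gauss_coeff :: "nat \<Rightarrow> nat \<Rightarrow> real" where
  "gauss_coeff K N = (\<Sum>m\<le>N. erfc_tail_coeff (N - m) / (4 ^ m * fact m * fact (K - 2 * m)))"

definition gauss_part :: "nat \<Rightarrow> real \<Rightarrow> real" where
  "gauss_part K x = (- 1) ^ Suc K / 2 * (\<Sum>N | 2 * N < K. x ^ (K - 1 - 2 * N) * gauss_coeff K N)"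

text \<open>The weights \<open>w\<close> are, up to sign, the coefficients of a Hermite polynomial
  divided by \<open>2 ^ K * fact K\<close>. Splitting \<open>Suc (Suc k)\<close> as
  \<open>2 * m + (Suc (Suc k) - 2 * m)\<close> cancels a factor of \<open>fact m\<close> in one part
  and a factor of the other factorial in the second. The hypothesis on \<open>N\<close> ensures that
  no subtraction is truncated.\<close>

lemma gauss_coeff_rec:
  assumes "2 * N \<le> Suc k"
  shows "2 * real (Suc (Suc k)) * gauss_coeff (Suc (Suc k)) N =
     2 * gauss_coeff (Suc k) N + (case N of 0 \<Rightarrow> 0 | Suc N' \<Rightarrow> gauss_coeff k N')"
proof -
  define w where "w = (\<lambda>K m. 1 / (4 ^ m * fact m * fact (K - 2 * m)) :: real)"
  have G: "gauss_coeff K N = (\<Sum>m\<le>N. erfc_tail_coeff (N - m) * w K m)" for K N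
    by (simp add: gauss_coeff_def w_def)
  have w: "2 * real (Suc (Suc k)) * w (Suc (Suc k)) m = 2 * w (Suc k) m + (case m of 0 \<Rightarrow> 0 | Suc m' \<Rightarrow> w k m')"
    if m: "m \<le> N" for m
  proof (cases m)
    case 0
    then show ?thesis by (simp add: w_def fact_Suc[of "Suc k"] del: fact_Suc of_nat_Suc)
  next
    case (Suc m')
    from m assms have "2 * m \<le> Suc k" by simp
    then obtain r where r: "Suc k = 2 * m + r" using le_iff_add by blast
    have e: "Suc (Suc k) - 2 * Suc m' = Suc r" "Suc k - 2 * Suc m' = r" "k - 2 * m' = Suc r"
      "real (Suc (Suc k)) = 2 * real (Suc m') + real (Suc r)"
      using r Suc by auto
    have "2 * (2 * M + R) * (1 / ((4 * p) * (M * q) * (R * f))) = 2 * (1 / ((4 * p) * (M * q) * f)) + 1 / (p * q * (R * f))"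
      if "M \<noteq> 0" "R \<noteq> 0" "p \<noteq> 0" "q \<noteq> 0" "f \<noteq> 0" for M R p q f :: real
      using that by (simp add: field_simps)
    then show ?thesis
      unfolding w_def Suc nat.case e power_Suc fact_Suc of_nat_mult by (simp del: of_nat_Suc)
  qed
  have "2 * real (Suc (Suc k)) * gauss_coeff (Suc (Suc k)) N =
      (\<Sum>m\<le>N. erfc_tail_coeff (N - m) * (2 * real (Suc (Suc k)) * w (Suc (Suc k)) m))"
    unfolding G by (simp only: sum_distrib_left mult_ac)
  also have "\<dots> = (\<Sum>m\<le>N. erfc_tail_coeff (N - m) * (2 * w (Suc k) m + (case m of 0 \<Rightarrow> 0 | Suc m' \<Rightarrow> w k m')))"
    by (intro sum.cong refl) (simp only: w atMost_iff)
  also have "\<dots> = 2 * gauss_coeff (Suc k) N + (\<Sum>m\<le>N. erfc_tail_coeff (N - m) * (case m of 0 \<Rightarrow> 0 | Suc m' \<Rightarrow> w k m'))"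
    unfolding G by (simp add: distrib_left sum.distrib sum_distrib_left mult_ac)
  also have "(\<Sum>m\<le>N. erfc_tail_coeff (N - m) * (case m of 0 \<Rightarrow> 0 | Suc m' \<Rightarrow> w k m')) =
      (case N of 0 \<Rightarrow> 0 | Suc N' \<Rightarrow> gauss_coeff k N')"
  proof (cases N)
    case (Suc N')
    show ?thesis unfolding Suc G by (subst sum.atMost_Suc_shift) simp
  qed simp
  finally show ?thesis .
qed

text \<open>On the diagonal the factorials of \<open>2 * (N - m)\<close> cancel, and an alternating
  binomial sum remains, the expansion of \<open>(1 - 1) ^ N\<close>. It is the coefficient of
  \<open>1 / x\<close> in the product with the asymptotic series.\<close>

lemma gauss_coeff_diag_eq_0:
  assumes "N > 0"
  shows "gauss_coeff (2 * N) N = 0"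
proof -
  have t: "erfc_tail_coeff (N - m) / (4 ^ m * fact m * fact (2 * N - 2 * m)) =
      1 / (4 ^ N * fact N) * (of_nat (N choose m) * 1 ^ m * (- 1) ^ (N - m))" if "m \<le> N" for m
  proof -
    have "(4::real) ^ N = 4 ^ (N - m) * 4 ^ m" using that by (simp flip: power_add)
    moreover have "2 * N - 2 * m = 2 * (N - m)" by simp
    ultimately show ?thesis using that
      by (simp add: erfc_tail_coeff_def binomial_fact field_simps)
  qed
  have "gauss_coeff (2 * N) N = 1 / (4 ^ N * fact N) * (\<Sum>m\<le>N. of_nat (N choose m) * 1 ^ m * (- 1) ^ (N - m))"
    unfolding gauss_coeff_def sum_distrib_left by (intro sum.cong refl t) simp
  also have "(\<Sum>m\<le>N. of_nat (N choose m) * 1 ^ m * (- 1) ^ (N - m)) = (1 + (- 1) :: real) ^ N"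
    by (rule binomial_ring[symmetric])
  finally show ?thesis using assms by simp
qed

lemma gauss_part_0: "gauss_part 0 x = 0"
  by (simp add: gauss_part_def)

lemma gauss_part_1: "gauss_part (Suc 0) x = 1 / 2"
proof -
  have "{N::nat. 2 * N < Suc 0} = {0}" by auto
  then show ?thesis by (simp add: gauss_part_def gauss_coeff_def erfc_tail_coeff_def)
qed

text \<open>The coefficients satisfy the recurrence term by term; only the constant term of \<open>x * gauss_part (Suc k) x\<close> has
  no counterpart, and it vanishes by \<open>gauss_coeff_diag_eq_0\<close>.\<close>

lemma gauss_part_Suc_Suc:
  "2 * real (Suc (Suc k)) * gauss_part (Suc (Suc k)) x = gauss_part k x - 2 * x * gauss_part (Suc k) x"
proof -
  define s :: real where "s = (- 1) ^ Suc k / 2"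
  have fin: "finite {N::nat. 2 * N < n}" for n
    by (rule finite_subset[of _ "{..n}"]) auto
  let ?I = "{N. 2 * N < Suc (Suc k)}"
  let ?X = "\<lambda>N. x ^ (Suc k - 2 * N)"
  have A2: "gauss_part (Suc (Suc k)) x = s * (\<Sum>N\<in>?I. ?X N * gauss_coeff (Suc (Suc k)) N)"
    by (simp add: gauss_part_def s_def)
  have A1: "x * gauss_part (Suc k) x = - s * (\<Sum>N\<in>?I. ?X N * gauss_coeff (Suc k) N)"
  proof -
    have "x * gauss_part (Suc k) x = - s * (\<Sum>N | 2 * N < Suc k. x * (x ^ (k - 2 * N) * gauss_coeff (Suc k) N))"
      by (simp add: gauss_part_def s_def sum_distrib_left mult_ac)
    also have "(\<Sum>N | 2 * N < Suc k. x * (x ^ (k - 2 * N) * gauss_coeff (Suc k) N)) =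
        (\<Sum>N | 2 * N < Suc k. ?X N * gauss_coeff (Suc k) N)"
      by (intro sum.cong) (auto simp: Suc_diff_le less_Suc_eq_le)
    also have "\<dots> = (\<Sum>N\<in>?I. ?X N * gauss_coeff (Suc k) N)"
    proof (rule sum.mono_neutral_left[OF fin])
      show "\<forall>N\<in>?I - {N. 2 * N < Suc k}. ?X N * gauss_coeff (Suc k) N = 0"
      proof
        fix N assume "N \<in> ?I - {N. 2 * N < Suc k}"
        then have "Suc k = 2 * N" "N > 0" by auto
        then show "?X N * gauss_coeff (Suc k) N = 0" using gauss_coeff_diag_eq_0[of N] by simp
      qed
    qed auto
    finally show ?thesis .
  qed
  have A0: "gauss_part k x = s * (\<Sum>N\<in>?I. ?X N * (case N of 0 \<Rightarrow> 0 | Suc N' \<Rightarrow> gauss_coeff k N'))"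
  proof -
    \<comment> \<open>The shift of \<open>N\<close> by one raises the power by two, which aligns the
      terms of \<open>gauss_part k\<close> with those of
      \<open>gauss_part (Suc (Suc k))\<close>.\<close>
    have I: "?I = insert 0 (Suc ` {N. 2 * N < k})"
    proof (intro set_eqI iffI)
      fix N assume "N \<in> ?I"
      then show "N \<in> insert 0 (Suc ` {N. 2 * N < k})" by (cases N) auto
    qed auto
    have "(\<Sum>N\<in>?I. ?X N * (case N of 0 \<Rightarrow> 0 | Suc N' \<Rightarrow> gauss_coeff k N')) =
        (\<Sum>N\<in>Suc ` {N. 2 * N < k}. ?X N * (case N of 0 \<Rightarrow> 0 | Suc N' \<Rightarrow> gauss_coeff k N'))"
      unfolding I by (subst sum.insert) (auto simp: fin)
    also have "\<dots> = (\<Sum>N | 2 * N < k. x ^ (k - 1 - 2 * N) * gauss_coeff k N)"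
      by (subst sum.reindex) (auto intro!: sum.cong)
    finally show ?thesis by (simp add: gauss_part_def s_def)
  qed
  have "2 * real (Suc (Suc k)) * gauss_part (Suc (Suc k)) x =
      s * (\<Sum>N\<in>?I. ?X N * (2 * real (Suc (Suc k)) * gauss_coeff (Suc (Suc k)) N))"
    unfolding A2 by (simp only: sum_distrib_left mult_ac)
  also have "(\<Sum>N\<in>?I. ?X N * (2 * real (Suc (Suc k)) * gauss_coeff (Suc (Suc k)) N)) =
     (\<Sum>N\<in>?I. ?X N * (2 * gauss_coeff (Suc k) N + (case N of 0 \<Rightarrow> 0 | Suc N' \<Rightarrow> gauss_coeff k N')))"
    by (intro sum.cong refl arg_cong2[where f = "(*)"] gauss_coeff_rec) auto
  also have "\<dots> = 2 * (\<Sum>N\<in>?I. ?X N * gauss_coeff (Suc k) N)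
      + (\<Sum>N\<in>?I. ?X N * (case N of 0 \<Rightarrow> 0 | Suc N' \<Rightarrow> gauss_coeff k N'))"
    by (simp only: distrib_left sum.distrib sum_distrib_left mult.left_commute)
  also have "s * \<dots> = gauss_part k x - 2 * (x * gauss_part (Suc k) x)"
  proof -
    have "s * (2 * u + v) = s * v - 2 * (- s * u)" for u v :: real by (simp add: algebra_simps)
    then show ?thesis unfolding A0 A1 .
  qed
  finally show ?thesis by (simp only: mult.assoc)
qed

text \<open>For fixed \<open>x\<close>, \<open>gauss_part\<close> (initial values \<open>0\<close>
  and \<open>1 / 2\<close>) and the Hermite factor (initial values \<open>1\<close> and
  \<open>- x\<close>) solve the recurrence of \<open>ierfc\<close>. The power
  \<open>\<i> ^ k\<close> adjusts the signs of the Hermite recurrence, so the combination that is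
  right for \<open>k = 0\<close> and \<open>k = 1\<close> is right throughout.\<close>

lemma ierfc_decomposition:
  "complex_of_real (ierfc (Suc k) x) = of_real (gauss_part k x * exp (- x\<^sup>2))
     + of_real (sqrt pi / 2 * erfc x) * (\<i> ^ k * hermite k (\<i> * of_real x) / (2 ^ k * fact k))"
proof (induction k rule: less_induct)
  case (less k)
  define b where "b = (\<lambda>k. \<i> ^ k * hermite k (\<i> * of_real x) / (2 ^ k * fact k))"
  define e where "e = complex_of_real (sqrt pi / 2 * erfc x)"
  define q where "q = exp (- x\<^sup>2)"
  have brec: "2 * of_nat (Suc (Suc j)) * b (Suc (Suc j)) = b j - 2 * of_real x * b (Suc j)" for j
  proof -
    have "2 * of_nat (Suc (Suc j)) * b (Suc (Suc j)) =
        \<i> ^ Suc (Suc j) * hermite (Suc (Suc j)) (\<i> * of_real x) / (2 ^ Suc j * fact (Suc j))"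
      unfolding b_def power_Suc[of "2::complex" "Suc j"] fact_Suc[of "Suc j"]
      by (simp del: of_nat_Suc fact_Suc power_Suc)
    also have "\<dots> = (\<i> ^ Suc (Suc j) * 2 * \<i> * of_real x * hermite (Suc j) (\<i> * of_real x)
         - \<i> ^ Suc (Suc j) * 2 * of_nat (Suc j) * hermite j (\<i> * of_real x)) / (2 ^ Suc j * fact (Suc j))"
      by (simp only: hermite_Suc_Suc right_diff_distrib mult.assoc)
    also have "\<dots> = - 2 * of_real x * b (Suc j) + 2 * of_nat (Suc j) * (\<i> ^ j * hermite j (\<i> * of_real x)) / (2 ^ Suc j * fact (Suc j))"
      unfolding b_def diff_divide_distrib by (simp del: of_nat_Suc fact_Suc add: mult_ac)
    also have "2 * of_nat (Suc j) * (\<i> ^ j * hermite j (\<i> * of_real x)) / (2 ^ Suc j * fact (Suc j)) = b j"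
      unfolding b_def power_Suc[of "2::complex" j] fact_Suc[of j]
      by (simp del: of_nat_Suc)
    finally show ?thesis by simp
  qed
  consider "k = 0" | "k = Suc 0" | j where "k = Suc (Suc j)" by (metis not0_implies_Suc)
  then have "complex_of_real (ierfc (Suc k) x) = of_real (gauss_part k x * q) + e * b k"
  proof cases
    case 1
    then show ?thesis by (simp add: gauss_part_0 b_def e_def hermite_0)
  next
    case 2
    then show ?thesis
      by (simp add: gauss_part_1 b_def e_def hermite_1 q_def field_simps)
  next
    case 3
    have IH: "complex_of_real (ierfc (Suc j) x) = of_real (gauss_part j x * q) + e * b j"
      "complex_of_real (ierfc (Suc (Suc j)) x) = of_real (gauss_part (Suc j) x * q) + e * b (Suc j)"
      using less[of j] less[of "Suc j"] 3 unfolding b_def e_def q_def by (simp_all del: ierfc.simps)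
    let ?c = "2 * of_nat (Suc (Suc j)) :: complex"
    have "?c * of_real (ierfc (Suc (Suc (Suc j))) x) = of_real (ierfc (Suc j) x - 2 * x * ierfc (Suc (Suc j)) x)"
      unfolding ierfc.simps(3)[of "Suc j"] by (simp del: ierfc.simps of_nat_Suc)
    also have "\<dots> = of_real ((gauss_part j x - 2 * x * gauss_part (Suc j) x) * q) + e * (b j - 2 * of_real x * b (Suc j))"
      using IH by (simp add: algebra_simps del: ierfc.simps)
    also have "\<dots> = ?c * (of_real (gauss_part (Suc (Suc j)) x * q) + e * b (Suc (Suc j)))"
      unfolding brec[symmetric] gauss_part_Suc_Suc[symmetric] by (simp add: algebra_simps)
    finally show ?thesis unfolding 3 by (simp del: ierfc.simps of_nat_Suc)
  qed
  then show ?case by (simp add: b_def e_def q_def del: ierfc.simps)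
qed

section \<open>Double factorials and the identification of H with an iterated integral\<close>

lemma double_fact_Suc: "double_fact (2 * int (Suc j) - 1) = (2 * int j + 1) * double_fact (2 * int j - 1)"
proof -
  have S: "{i \<in> {1..2 * int (Suc j) - 1}. even (2 * int (Suc j) - 1 - i)} =
      insert (2 * int j + 1) {i \<in> {1..2 * int j - 1}. even (2 * int j - 1 - i)}"
  proof (intro set_eqI iffI)
    fix i assume i: "i \<in> {i \<in> {1..2 * int (Suc j) - 1}. even (2 * int (Suc j) - 1 - i)}"
    then have "odd i" "1 \<le> i" "i \<le> 2 * int j + 1" by auto
    moreover from this have "i \<noteq> 2 * int j" by auto
    ultimately show "i \<in> insert (2 * int j + 1) {i \<in> {1..2 * int j - 1}. even (2 * int j - 1 - i)}"
      by auto
  qed auto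
  show ?thesis
    unfolding double_fact_def S
    by (subst prod.insert) (auto intro!: finite_subset[of _ "{1..2 * int j - 1}"])
qed

lemma double_fact_eq: "of_int (double_fact (2 * int j - 1)) = (fact (2 * j) / (2 ^ j * fact j) :: real)"
proof (induction j)
  case 0
  then show ?case by (simp add: double_fact_def)
next
  case (Suc j)
  have "real_of_int (double_fact (2 * int (Suc j) - 1)) = (2 * real j + 1) * (fact (2 * j) / (2 ^ j * fact j))"
    using Suc unfolding double_fact_Suc by simp
  also have "\<dots> = fact (2 * Suc j) / (2 ^ Suc j * fact (Suc j))"
  proof -
    have "fact (2 * Suc j) = 2 * real (Suc j) * ((2 * real j + 1) * fact (2 * j))"
      by (simp add: algebra_simps)
    then show ?thesis by (simp only: fact_Suc[of j] power_Suc) (simp del: of_nat_Suc)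
  qed
  finally show ?case .
qed

text \<open>For \<open>n = 0\<close> this is a term of the dual theta series. The powers of
  \<open>\<epsilon>\<close> and \<open>- 4\<close> are those for which the derivative in
  \<open>\<epsilon>\<close> lowers \<open>n\<close> by one and changes the sign.\<close>

definition mode_fun :: "nat \<Rightarrow> real \<Rightarrow> real \<Rightarrow> real" where
  "mode_fun n p \<epsilon> = (- 4) ^ n * sqrt pi * \<epsilon> powr (real n - 1 / 2) * ierfc (2 * n) (pi * p / sqrt \<epsilon>)"

text \<open>This is the inner double sum of \<open>P_fun\<close>. Since \<open>(2j - 1)!!\<close> is
  \<open>fact (2 * j) / (2 ^ j * fact j)\<close>, the coefficient \<open>erfc_tail_coeff j\<close>
  equals \<open>(- 1 / 2) ^ j\<close> times that double factorial.\<close>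

lemma gauss_part_odd:
  assumes "n \<ge> 1"
  shows "gauss_part (2 * n - 1) x = 1 / 2 * (\<Sum>k = 0..n - 1. (- 1 / 2) ^ k * x ^ (2 * n - 2 - 2 * k) *
     (\<Sum>m = 0..k. (- 1) ^ m * of_int (double_fact (2 * int k - 2 * int m - 1)) / (2 ^ m * fact m * fact (2 * n - 1 - 2 * m))))"
proof -
  obtain l where l: "n = Suc l" using assms by (cases n) auto
  have set: "{N. 2 * N < 2 * n - 1} = {0..n - 1}" using l by auto
  have c: "gauss_coeff (2 * n - 1) k = (- 1 / 2) ^ k * (\<Sum>m = 0..k. (- 1) ^ m * of_int (double_fact (2 * int k - 2 * int m - 1))
       / (2 ^ m * fact m * fact (2 * n - 1 - 2 * m)))" for k
    unfolding gauss_coeff_def sum_distrib_left atMost_atLeast0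
  proof (intro sum.cong refl)
    fix m assume "m \<in> {0..k}"
    then have "2 * int k - 2 * int m - 1 = 2 * int (k - m) - 1" by (simp add: of_nat_diff)
    then have df: "real_of_int (double_fact (2 * int k - 2 * int m - 1)) = fact (2 * (k - m)) / (2 ^ (k - m) * fact (k - m))"
      by (simp only: double_fact_eq)
    have p: "(- 1 / 2 :: real) ^ k = (- 1 / 2) ^ (k - m) * (- 1 / 2) ^ m"
      using \<open>m \<in> {0..k}\<close> by (simp flip: power_add)
    have q: "(4::real) ^ j = 2 ^ j * 2 ^ j" for j by (simp flip: power_mult_distrib)
    have r: "(- 1 / 2 :: real) ^ j = (- 1) ^ j / 2 ^ j" for j by (rule power_divide)
    have u: "(- 1 :: real) ^ m * (- 1) ^ m = 1" by (simp flip: power_mult_distrib)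
    show "erfc_tail_coeff (k - m) / (4 ^ m * fact m * fact (2 * n - 1 - 2 * m)) =
      (- 1 / 2) ^ k * ((- 1) ^ m * of_int (double_fact (2 * int k - 2 * int m - 1)) / (2 ^ m * fact m * fact (2 * n - 1 - 2 * m)))"
      unfolding df p unfolding r erfc_tail_coeff_def q using u
      by (simp add: divide_simps)
  qed
  have idx: "2 * n - 1 - 1 - 2 * k = 2 * n - 2 - 2 * k" for k by simp
  have "gauss_part (2 * n - 1) x = 1 / 2 * (\<Sum>k = 0..n - 1. x ^ (2 * n - 1 - 1 - 2 * k) * gauss_coeff (2 * n - 1) k)"
    unfolding gauss_part_def set by (simp add: l)
  also have "\<dots> = 1 / 2 * (\<Sum>k = 0..n - 1. (- 1 / 2) ^ k * x ^ (2 * n - 2 - 2 * k) *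
     (\<Sum>m = 0..k. (- 1) ^ m * of_int (double_fact (2 * int k - 2 * int m - 1)) / (2 ^ m * fact m * fact (2 * n - 1 - 2 * m))))"
    unfolding c idx by (simp only: mult_ac)
  finally show ?thesis .
qed

text \<open>In the variable \<open>x\<close> both halves of \<open>H\<close> carry the same scale
  \<open>C\<close>: \<open>P\<close> is \<open>C\<close> times the Gaussian part, and
  \<open>- Q'\<close> is \<open>C * sqrt pi / 2\<close> times the Hermite part. In particular the
  values of \<open>H\<close> are real.\<close>

lemma H_fun_eq_mode_fun:
  assumes g: "g \<ge> 2" and \<epsilon>: "\<epsilon> > 0"
  shows "H_fun g \<epsilon> p = of_real (mode_fun (g - 1) p \<epsilon>)"
proof -
  define n where "n = g - 1"
  define x where "x = pi * p / sqrt \<epsilon>"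
  define C where "C = (- 4) ^ n * sqrt pi * \<epsilon> powr (real n - 1 / 2)"
  have n: "n \<ge> 1" "g = Suc n" using g by (auto simp: n_def)
  obtain l where l: "n = Suc l" using n by (cases n) auto
  have idx: "2 * g - 3 = 2 * n - 1" "g - 2 = n - 1" "real g - 3 / 2 = real n - 1 / 2"
    "2 * g - 4 = 2 * n - 2"
    using n by auto
  have mode: "mode_fun n p \<epsilon> = C * ierfc (Suc (2 * n - 1)) x"
    using n(1) by (simp add: mode_fun_def C_def x_def)
  have p: "p = sqrt \<epsilon> / pi * x" using \<epsilon> by (simp add: x_def)
  have ex: "exp (- pi\<^sup>2 * p\<^sup>2 / \<epsilon>) = exp (- x\<^sup>2)"
    using \<epsilon> by (simp add: x_def power_mult_distrib power_divide)
  have P: "P_fun g \<epsilon> p = C * gauss_part (2 * n - 1) x"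
  proof -
    \<comment> \<open>Only the scalar in front of each inner sum differs between the two forms. With
      \<open>n - 1 = k + j\<close> the powers of \<open>\<epsilon> / pi\<^sup>2\<close> combine to
      exponent \<open>n - 1\<close> independently of \<open>k\<close>, and
      \<open>pi ^ (2 * n - 1)\<close> then cancels down to \<open>sqrt pi\<close>.\<close>
    have pre: "(- 1) ^ n * (2 * pi) ^ (2 * n - 1) * sqrt (\<epsilon> / pi) * ((- \<epsilon> / (2 * pi\<^sup>2)) ^ k * p ^ (2 * n - 2 - 2 * k))
       = C * (1 / 2) * ((- 1 / 2) ^ k * x ^ (2 * n - 2 - 2 * k))" if k: "k \<le> n - 1" for k
    proof -
      obtain j where j: "l = k + j" using k l by (auto simp: le_iff_add)
      have e: "2 * n - 2 - 2 * k = 2 * j" "2 * n - 1 = Suc (2 * l)" using l j by auto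
      have pj: "p ^ (2 * j) = (\<epsilon> / pi\<^sup>2) ^ j * x ^ (2 * j)"
        unfolding p power_mult using \<epsilon> by (simp add: power_mult_distrib power_divide)
      have pk: "(- \<epsilon> / (2 * pi\<^sup>2)) ^ k = (- 1 / 2) ^ k * (\<epsilon> / pi\<^sup>2) ^ k"
        by (simp flip: power_mult_distrib)
      have "(\<epsilon> / pi\<^sup>2) ^ k * (\<epsilon> / pi\<^sup>2) ^ j = (\<epsilon> / pi\<^sup>2) ^ l" by (simp add: j power_add)
      also have "\<dots> = \<epsilon> ^ l / pi ^ (2 * l)" by (simp add: power_divide power_mult)
      finally have pl: "(\<epsilon> / pi\<^sup>2) ^ k * (\<epsilon> / pi\<^sup>2) ^ j = \<epsilon> ^ l / pi ^ (2 * l)" .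
      have "real n - 1 / 2 = real l + 1 / 2" by (simp add: l)
      then have Ce: "C = (- 4) ^ n * sqrt pi * (\<epsilon> ^ l * sqrt \<epsilon>)"
        using \<epsilon> by (simp add: C_def powr_add powr_realpow powr_half_sqrt)
      have sq: "pi * sqrt (\<epsilon> / pi) = sqrt pi * sqrt \<epsilon>"
      proof -
        have "pi * sqrt (\<epsilon> / pi) = (pi / sqrt pi) * sqrt \<epsilon>" by (simp add: real_sqrt_divide)
        also have "pi / sqrt pi = sqrt pi" by (rule real_div_sqrt) simp
        finally show ?thesis .
      qed
      have two: "(- 1) ^ n * 2 ^ Suc (2 * l) = (- 4) ^ n * (1 / 2 :: real)"
      proof -
        have "(- 4 :: real) ^ n = (- 1) ^ n * 4 ^ n" by (simp flip: power_mult_distrib)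
        also have "(4::real) ^ n = 2 * 2 ^ Suc (2 * l)" by (simp add: l power_mult)
        finally show ?thesis by simp
      qed
      have "(- 1) ^ n * (2 * pi) ^ (2 * n - 1) * sqrt (\<epsilon> / pi) * ((- \<epsilon> / (2 * pi\<^sup>2)) ^ k * p ^ (2 * n - 2 - 2 * k))
         = ((- 1) ^ n * 2 ^ Suc (2 * l)) * (pi * sqrt (\<epsilon> / pi)) * pi ^ (2 * l) * ((\<epsilon> / pi\<^sup>2) ^ k * (\<epsilon> / pi\<^sup>2) ^ j)
            * ((- 1 / 2) ^ k * x ^ (2 * j))"
        unfolding e pj pk power_mult_distrib by (simp only: power_Suc mult_ac)
      also have "\<dots> = ((- 4) ^ n * (1 / 2)) * (sqrt pi * sqrt \<epsilon>) * pi ^ (2 * l) * (\<epsilon> ^ l / pi ^ (2 * l))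
            * ((- 1 / 2) ^ k * x ^ (2 * j))"
        unfolding two sq pl ..
      also have "\<dots> = C * (1 / 2) * ((- 1 / 2) ^ k * x ^ (2 * j))"
        unfolding Ce by simp
      finally show ?thesis unfolding e .
    qed
    have idx2: "2 * g - 2 * m - 3 = 2 * n - 1 - 2 * m" for m using n by auto
    have "P_fun g \<epsilon> p = (\<Sum>k = 0..n - 1. (- 1) ^ n * (2 * pi) ^ (2 * n - 1) * sqrt (\<epsilon> / pi) *
        ((- \<epsilon> / (2 * pi\<^sup>2)) ^ k * p ^ (2 * n - 2 - 2 * k)) *
        (\<Sum>m = 0..k. (- 1) ^ m * of_int (double_fact (2 * int k - 2 * int m - 1)) / (2 ^ m * fact m * fact (2 * n - 1 - 2 * m))))"
      unfolding P_fun_def idx idx2 n_def[symmetric] sum_distrib_left[of "_ * sqrt _"] by (simp only: mult.assoc)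
    also have "\<dots> = (\<Sum>k = 0..n - 1. C * (1 / 2) * ((- 1 / 2) ^ k * x ^ (2 * n - 2 - 2 * k)) *
        (\<Sum>m = 0..k. (- 1) ^ m * of_int (double_fact (2 * int k - 2 * int m - 1)) / (2 ^ m * fact m * fact (2 * n - 1 - 2 * m))))"
      by (intro sum.cong refl arg_cong2[where f = "(*)"] pre) simp
    also have "\<dots> = C * gauss_part (2 * n - 1) x"
      unfolding gauss_part_odd[OF n(1)] sum_distrib_left[of C] sum_distrib_left[of "1 / 2"] by (simp only: mult.assoc)
    finally show ?thesis .
  qed
  have Q: "- Q'_fun g \<epsilon> p = of_real (C * (sqrt pi / 2)) * (\<i> ^ (2 * n - 1) * hermite (2 * n - 1) (\<i> * of_real x) / (2 ^ (2 * n - 1) * fact (2 * n - 1)))"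
  proof -
    have i: "\<i> ^ (2 * n - 1) = - ((- 1) ^ n) * \<i>"
      by (simp add: l power_mult)
    have pp: "sqrt pi * sqrt pi = pi" by simp
    have "C * (sqrt pi / 2) = (- 1) ^ n * pi * \<epsilon> powr (real n - 1 / 2) * 2 ^ (2 * n - 1)"
    proof -
      have "(- 4 :: real) ^ n = (- 1) ^ n * 4 ^ n" by (simp flip: power_mult_distrib)
      also have "(4::real) ^ n = 2 * 2 ^ (2 * n - 1)" by (simp add: l power_mult)
      finally have "C * (sqrt pi / 2) = (- 1) ^ n * (sqrt pi * sqrt pi) * \<epsilon> powr (real n - 1 / 2) * 2 ^ (2 * n - 1)"
        unfolding C_def by (simp del: real_sqrt_mult_self)
      then show ?thesis unfolding pp .
    qed
    then have C: "complex_of_real (C * (sqrt pi / 2)) = (- 1) ^ n * of_real (pi * \<epsilon> powr (real n - 1 / 2)) * 2 ^ (2 * n - 1)"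
      by (simp only: of_real_mult of_real_power of_real_minus of_real_1 of_real_numeral mult.assoc)
    have u: "(- 1 :: complex) ^ n * (- ((- 1) ^ n) * \<i>) = - \<i>" 
      by (simp flip: power_mult_distrib mult.assoc)
    have gen: "a * r * t * (d * h / (t * f)) = (a * d) * r / f * h" if "t \<noteq> 0" for a r t d h f :: complex
      using that by simp
    have "of_real (C * (sqrt pi / 2)) * (\<i> ^ (2 * n - 1) * hermite (2 * n - 1) (\<i> * of_real x) / (2 ^ (2 * n - 1) * fact (2 * n - 1)))
      = - \<i> * of_real (pi * \<epsilon> powr (real n - 1 / 2)) / fact (2 * n - 1) * hermite (2 * n - 1) (\<i> * of_real x)"
      unfolding C i by (subst gen) (simp_all only: u, simp)
    also have "\<dots> = - Q'_fun g \<epsilon> p"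
      unfolding Q'_fun_def idx x_def by simp
    finally show ?thesis by simp
  qed
  have "H_fun g \<epsilon> p = of_real (exp (- x\<^sup>2) * (C * gauss_part (2 * n - 1) x)) + of_real (erfc x) * (- Q'_fun g \<epsilon> p)"
    unfolding H_fun_def ex P x_def[symmetric] by simp
  also have "\<dots> = of_real C * of_real (ierfc (Suc (2 * n - 1)) x)"
    unfolding Q ierfc_decomposition by (simp add: algebra_simps)
  finally show ?thesis unfolding n_def[symmetric] mode by simp
qed

section \<open>Descent in the genus\<close>

definition damped_zeta :: "nat \<Rightarrow> real \<Rightarrow> real" where
  "damped_zeta n \<epsilon> = (\<Sum>l. exp (- (\<epsilon> * (real (Suc l))\<^sup>2)) / real (Suc l) ^ (2 * n))"

text \<open>Zeta at \<open>2 * n\<close>. At \<open>n = 0\<close> the series diverges and the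
  continued value is inserted; it is the constant that theta inversion produces.\<close>

definition zeta_value :: "nat \<Rightarrow> real" where
  "zeta_value n = (if n = 0 then - 1 / 2 else (\<Sum>l. 1 / real (Suc l) ^ (2 * n)))"

text \<open>Halving \<open>2 ^ n\<close> keeps the value right for \<open>n = 0\<close>, where a
  truncated exponent \<open>n - 1\<close> would give 1 in place of \<open>1 / 2\<close>.\<close>

definition half_power_coeff :: "nat \<Rightarrow> real" where
  "half_power_coeff n = (- 1) ^ n * sqrt pi * 2 ^ n / (2 * of_int (double_fact (2 * int n - 1)))"

definition mode_sum :: "nat \<Rightarrow> real \<Rightarrow> real" where
  "mode_sum n \<epsilon> = (\<Sum>m. mode_fun n (real (Suc m)) \<epsilon>)"

lemma damped_zeta_term_bound: "\<bar>exp (- (\<epsilon> * (real (Suc l))\<^sup>2)) / real (Suc l) ^ (2 * n)\<bar> \<le> exp (- (\<epsilon> * (real (Suc l))\<^sup>2))"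
  by (simp add: divide_le_eq mult_le_cancel_left1 del: of_nat_Suc)

lemma summable_damped_zeta:
  assumes "\<epsilon> > 0"
  shows "summable (\<lambda>l. exp (- (\<epsilon> * (real (Suc l))\<^sup>2)) / real (Suc l) ^ (2 * n))"
  by (rule summable_comparison_test'[of "\<lambda>l. exp (- (\<epsilon> * (real (Suc l))\<^sup>2))" 0])
     (use damped_zeta_term_bound summable_exp_neg_square[OF assms] in \<open>auto simp del: of_nat_Suc\<close>)

lemma damped_zeta_has_real_derivative:
  assumes \<epsilon>: "\<epsilon> > 0"
  shows "(damped_zeta (Suc n) has_real_derivative - damped_zeta n \<epsilon>) (at \<epsilon>)"
proof -
  let ?f = "\<lambda>l t. exp (- (t * (real (Suc l))\<^sup>2)) / real (Suc l) ^ (2 * Suc n)"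
  let ?f' = "\<lambda>l t. - (exp (- (t * (real (Suc l))\<^sup>2)) / real (Suc l) ^ (2 * n))"
  have "(\<lambda>t. \<Sum>l. ?f l t) = damped_zeta (Suc n)" by (rule ext) (simp add: damped_zeta_def)
  \<comment> \<open>For \<open>n = 0\<close> the differentiated terms have no decay except the
    Gaussian one; staying above \<open>\<epsilon> / 2\<close> gives a summable majorant that does
    not depend on \<open>t\<close>.\<close>
  moreover have "((\<lambda>t. \<Sum>l. ?f l t) has_real_derivative (\<Sum>l. ?f' l \<epsilon>)) (at \<epsilon>)"
  proof (rule has_field_derivative_series'(2)[where S = "{\<epsilon> / 2<..}" and x0 = \<epsilon>])
    show "(?f l has_real_derivative ?f' l t) (at t within {\<epsilon> / 2<..})" for l t
    proof -
      have "(?f l has_real_derivative (exp (- (t * (real (Suc l))\<^sup>2)) * - (1 * (real (Suc l))\<^sup>2)) / real (Suc l) ^ (2 * Suc n))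
          (at t within {\<epsilon> / 2<..})"
        by (intro DERIV_cdivide) (auto intro!: derivative_eq_intros simp del: of_nat_Suc)
      moreover have "(exp (- (t * (real (Suc l))\<^sup>2)) * - (1 * (real (Suc l))\<^sup>2)) / real (Suc l) ^ (2 * Suc n) = ?f' l t"
        by (simp add: power2_eq_square del: of_nat_Suc)
      ultimately show ?thesis by simp
    qed
    have "uniformly_convergent_on {\<epsilon> / 2<..} (\<lambda>N t. \<Sum>l<N. ?f' l t)"
    proof (rule Weierstrass_m_test'[OF _ summable_exp_neg_square[of "\<epsilon> / 2"]])
      fix l t assume t: "t \<in> {\<epsilon> / 2<..}"
      have "norm (?f' l t) \<le> exp (- (t * (real (Suc l))\<^sup>2))"
        using damped_zeta_term_bound[of t l n] by simp
      also have "\<dots> \<le> exp (- (\<epsilon> / 2) * (real (Suc l))\<^sup>2)"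
        using t by (simp add: mult_right_mono del: of_nat_Suc)
      finally show "norm (?f' l t) \<le> exp (- (\<epsilon> / 2) * (real (Suc l))\<^sup>2)" .
    qed (use \<epsilon> in simp)
    then show "uniformly_convergent_on {\<epsilon> / 2<..} (\<lambda>N t. \<Sum>l<N. ?f' l t)" .
    show "summable (\<lambda>l. ?f l \<epsilon>)" by (rule summable_damped_zeta[OF \<epsilon>])
  qed (use \<epsilon> in \<open>auto simp: interior_open\<close>)
  moreover have "(\<Sum>l. ?f' l \<epsilon>) = - damped_zeta n \<epsilon>"
    unfolding damped_zeta_def by (rule suminf_minus[OF summable_damped_zeta[OF \<epsilon>]])
  ultimately show ?thesis by simp
qed

text \<open>With exponent at least 2 the undamped series is itself a majorant, so the sum is
  continuous up to \<open>\<epsilon> = 0\<close>. For exponent 0 it would diverge there, hence the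
  successor.\<close>

lemma damped_zeta_tendsto: "(damped_zeta (Suc n) \<longlongrightarrow> zeta_value (Suc n)) (at_right 0)"
proof -
  let ?f = "\<lambda>l t. exp (- (t * (real (Suc l))\<^sup>2)) / real (Suc l) ^ (2 * Suc n)"
  have s: "summable (\<lambda>l. 1 / real (Suc l) ^ (2 * Suc n))"
    by (rule summable_inverse_Suc_power) simp
  have ul: "uniform_limit {0..} (\<lambda>N t. \<Sum>l<N. ?f l t) (\<lambda>t. \<Sum>l. ?f l t) sequentially"
  proof (rule Weierstrass_m_test[OF _ s])
    fix l and t :: real assume t: "t \<in> {0..}"
    show "norm (?f l t) \<le> 1 / real (Suc l) ^ (2 * Suc n)"
      using t by (simp add: divide_right_mono del: of_nat_Suc power_Suc)
  qed
  have "continuous_on {0..} (\<lambda>t. \<Sum>l. ?f l t)"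
    by (rule uniform_limit_theorem[OF _ ul])
       (auto intro!: always_eventually continuous_intros simp del: of_nat_Suc power_Suc)
  then have "((\<lambda>t. \<Sum>l. ?f l t) \<longlongrightarrow> (\<Sum>l. ?f l 0)) (at 0 within {0..})"
    unfolding continuous_on_def by (rule bspec) simp
  then have "((\<lambda>t. \<Sum>l. ?f l t) \<longlongrightarrow> (\<Sum>l. ?f l 0)) (at_right 0)"
    by (rule tendsto_mono[OF at_le, rotated]) auto
  then show ?thesis
    unfolding damped_zeta_def[abs_def] zeta_value_def by (simp del: of_nat_Suc power_Suc)
qed

text \<open>The power of \<open>\<epsilon>\<close> and the argument of \<open>ierfc\<close> both
  depend on \<open>\<epsilon>\<close>. The two resulting terms are
  \<open>2 * real (Suc (2 * n)) * A\<close> and \<open>2 * x * B\<close> up to a common factor, and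
  the recurrence adds them up to \<open>ierfc (2 * n) x\<close>. The common factor contains
  \<open>1 / 4\<close>, which cancels one \<open>- 4\<close> up to sign.\<close>

lemma mode_fun_has_real_derivative:
  assumes \<epsilon>: "\<epsilon> > 0"
  shows "(mode_fun (Suc n) p has_real_derivative - mode_fun n p \<epsilon>) (at \<epsilon>)"
proof -
  define x where "x = pi * p / sqrt \<epsilon>"
  have dx: "((\<lambda>t. pi * p / sqrt t) has_real_derivative - (x / (2 * \<epsilon>))) (at \<epsilon>)"
    using \<epsilon> by (auto intro!: derivative_eq_intros simp: x_def field_simps)
  have dI: "((\<lambda>t. ierfc (Suc (Suc (2 * n))) (pi * p / sqrt t)) has_real_derivative
      - ierfc (Suc (2 * n)) x * - (x / (2 * \<epsilon>))) (at \<epsilon>)"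
    by (rule DERIV_chain2[OF _ dx]) (use ierfc_has_real_derivative x_def in blast)
  have dp: "((\<lambda>t. t powr (real n + 1 / 2)) has_real_derivative (real n + 1 / 2) * \<epsilon> powr (real n - 1 / 2)) (at \<epsilon>)"
    using has_real_derivative_powr[OF \<epsilon>, of "real n + 1 / 2"] by (simp add: algebra_simps)
  have "((\<lambda>t. (- 4) ^ Suc n * sqrt pi * (t powr (real n + 1 / 2) * ierfc (Suc (Suc (2 * n))) (pi * p / sqrt t)))
     has_real_derivative (- 4) ^ Suc n * sqrt pi * ((real n + 1 / 2) * \<epsilon> powr (real n - 1 / 2) * ierfc (Suc (Suc (2 * n))) x
        + (- ierfc (Suc (2 * n)) x * - (x / (2 * \<epsilon>))) * \<epsilon> powr (real n + 1 / 2))) (at \<epsilon>)"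
    using DERIV_cmult[OF DERIV_mult[OF dp dI], of "(- 4) ^ Suc n * sqrt pi"] unfolding x_def .
  moreover have "(\<lambda>t. (- 4) ^ Suc n * sqrt pi * (t powr (real n + 1 / 2) * ierfc (Suc (Suc (2 * n))) (pi * p / sqrt t)))
     = mode_fun (Suc n) p"
  proof (rule ext)
    fix t
    have "real (Suc n) - 1 / 2 = real n + 1 / 2" "2 * Suc n = Suc (Suc (2 * n))" by simp_all
    then show "(- 4) ^ Suc n * sqrt pi * (t powr (real n + 1 / 2) * ierfc (Suc (Suc (2 * n))) (pi * p / sqrt t))
        = mode_fun (Suc n) p t"
      unfolding mode_fun_def by (simp only: mult.assoc)
  qed
  moreover have "(- 4) ^ Suc n * sqrt pi * ((real n + 1 / 2) * \<epsilon> powr (real n - 1 / 2) * ierfc (Suc (Suc (2 * n))) x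
        + (- ierfc (Suc (2 * n)) x * - (x / (2 * \<epsilon>))) * \<epsilon> powr (real n + 1 / 2)) = - mode_fun n p \<epsilon>"
  proof -
    define A B where "A = ierfc (Suc (Suc (2 * n))) x" and "B = ierfc (Suc (2 * n)) x"
    have "\<epsilon> powr (real n + 1 / 2) = \<epsilon> powr (1 + (real n - 1 / 2))"
      by (rule arg_cong[where f = "\<lambda>s. \<epsilon> powr s"]) simp
    also have "\<dots> = \<epsilon> * \<epsilon> powr (real n - 1 / 2)" using \<epsilon> by (subst powr_add) simp
    finally have pw: "\<epsilon> powr (real n + 1 / 2) = \<epsilon> * \<epsilon> powr (real n - 1 / 2)" .
    have "(real n + 1 / 2) * \<epsilon> powr (real n - 1 / 2) * A + (- B * - (x / (2 * \<epsilon>))) * \<epsilon> powr (real n + 1 / 2)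
       = \<epsilon> powr (real n - 1 / 2) / 4 * (2 * real (Suc (2 * n)) * A + 2 * x * B)"
      unfolding pw using \<epsilon> by (simp add: field_simps)
    also have "2 * real (Suc (2 * n)) * A + 2 * x * B = ierfc (2 * n) x"
      unfolding A_def B_def ierfc_Suc_Suc by simp
    finally show ?thesis unfolding A_def B_def mode_fun_def x_def[symmetric] by (simp del: ierfc.simps)
  qed
  ultimately show ?thesis by (simp only:)
qed

text \<open>From \<open>pi * p \<ge> 1\<close> follows
  \<open>x\<^sup>2 \<ge> 1 / \<epsilon>\<close>, so the denominator \<open>(2 * x) ^ (2 * n)\<close>
  cancels \<open>4 ^ n\<close> and gains a further \<open>\<epsilon> ^ n\<close>. The exponential is
  kept intact for the summation over \<open>p\<close>.\<close>

lemma mode_fun_bound: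
  assumes \<epsilon>: "\<epsilon> > 0" and p: "p \<ge> 1"
  shows "\<bar>mode_fun n p \<epsilon>\<bar> \<le> sqrt pi * \<epsilon> powr (2 * real n - 1 / 2) * exp (- (pi\<^sup>2 * p\<^sup>2 / \<epsilon>))"
proof -
  define x where "x = pi * p / sqrt \<epsilon>"
  have x: "x > 0" using \<epsilon> p by (simp add: x_def)
  have x2: "x\<^sup>2 = pi\<^sup>2 * p\<^sup>2 / \<epsilon>" using \<epsilon> by (simp add: x_def power_mult_distrib power_divide)
  have "0 \<le> ierfc (2 * n) x \<and> ierfc (2 * n) x \<le> exp (- x\<^sup>2) / (2 * x) ^ (2 * n)"
  proof (cases n)
    case (Suc l)
    then show ?thesis using ierfc_bounds[OF x, of "Suc (2 * l)"] by (simp del: ierfc.simps power_Suc)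
  qed simp
  then have I: "\<bar>ierfc (2 * n) x\<bar> \<le> exp (- x\<^sup>2) / (2 * x) ^ (2 * n)" by simp
  have "1 \<le> pi\<^sup>2 * p\<^sup>2"
  proof -
    have "1 * 1 \<le> pi\<^sup>2 * p\<^sup>2" using p pi_gt3 by (intro mult_mono one_le_power) auto
    then show ?thesis by simp
  qed
  then have "1 / \<epsilon> \<le> x\<^sup>2" unfolding x2 using \<epsilon> by (intro divide_right_mono) auto
  then have "(1 / \<epsilon>) ^ n \<le> (x\<^sup>2) ^ n" using \<epsilon> by (intro power_mono) auto
  then have xn: "1 / (x\<^sup>2) ^ n \<le> \<epsilon> ^ n" using \<epsilon> x by (simp add: power_divide field_simps)
  have x4: "(2 * x) ^ (2 * n) = 4 ^ n * (x\<^sup>2) ^ n" by (simp add: power_mult power_mult_distrib)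
  have "\<bar>mode_fun n p \<epsilon>\<bar> = 4 ^ n * sqrt pi * \<epsilon> powr (real n - 1 / 2) * \<bar>ierfc (2 * n) x\<bar>"
    unfolding mode_fun_def x_def[symmetric] by (simp add: abs_mult power_abs)
  also have "\<dots> \<le> 4 ^ n * sqrt pi * \<epsilon> powr (real n - 1 / 2) * (exp (- x\<^sup>2) / (2 * x) ^ (2 * n))"
    by (intro mult_left_mono I) auto
  also have "\<dots> = sqrt pi * \<epsilon> powr (real n - 1 / 2) * exp (- x\<^sup>2) * (1 / (x\<^sup>2) ^ n)"
    unfolding x4 by simp
  also have "\<dots> \<le> sqrt pi * \<epsilon> powr (real n - 1 / 2) * exp (- x\<^sup>2) * \<epsilon> ^ n"
    by (intro mult_left_mono xn) auto
  also have "\<dots> = sqrt pi * (\<epsilon> powr (real n - 1 / 2) * \<epsilon> powr real n) * exp (- x\<^sup>2)"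
    using \<epsilon> by (simp add: powr_realpow)
  also have "\<epsilon> powr (real n - 1 / 2) * \<epsilon> powr real n = \<epsilon> powr (2 * real n - 1 / 2)"
    by (simp add: powr_add[symmetric])
  finally show ?thesis unfolding x2 .
qed

lemma summable_exp_modes:
  assumes "\<epsilon> > 0"
  shows "summable (\<lambda>m. exp (- (pi\<^sup>2 * (real (Suc m))\<^sup>2 / \<epsilon>)))"
  using summable_exp_neg_square[of "pi\<^sup>2 / \<epsilon>"] assms by simp

lemma summable_mode_fun:
  assumes "\<epsilon> > 0"
  shows "summable (\<lambda>m. mode_fun n (real (Suc m)) \<epsilon>)"
  by (rule summable_comparison_test'[OF summable_mult[OF summable_exp_modes[OF assms],
          of "sqrt pi * \<epsilon> powr (2 * real n - 1 / 2)"], of 0])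
     (use mode_fun_bound[OF assms] in simp)

lemma mode_sum_has_real_derivative:
  assumes \<epsilon>: "\<epsilon> > 0"
  shows "(mode_sum (Suc n) has_real_derivative - mode_sum n \<epsilon>) (at \<epsilon>)"
proof -
  \<comment> \<open>The upper end is needed because the decay of
    \<open>exp (- (pi\<^sup>2 * m\<^sup>2 / t))\<close> in \<open>m\<close> weakens as
    \<open>t\<close> grows; the lower end bounds \<open>t powr (- 1 / 2)\<close>.\<close>
  let ?S = "{\<epsilon> / 2<..<2 * \<epsilon>}"
  define C where "C = sqrt pi * ((2 * \<epsilon>) powr (2 * real n) * (\<epsilon> / 2) powr (- 1 / 2))"
  have "((\<lambda>t. \<Sum>m. mode_fun (Suc n) (real (Suc m)) t) has_real_derivative (\<Sum>m. - mode_fun n (real (Suc m)) \<epsilon>)) (at \<epsilon>)"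
  proof (rule has_field_derivative_series'(2)[where S = ?S and x0 = \<epsilon>])
    show "(mode_fun (Suc n) (real (Suc m)) has_real_derivative - mode_fun n (real (Suc m)) t) (at t within ?S)"
      if "t \<in> ?S" for m t
      by (rule has_field_derivative_at_within, rule mode_fun_has_real_derivative) (use that \<epsilon> in auto)
    show "uniformly_convergent_on ?S (\<lambda>N t. \<Sum>m<N. - mode_fun n (real (Suc m)) t)"
    proof (rule Weierstrass_m_test'[OF _ summable_mult[OF summable_exp_modes[of "2 * \<epsilon>"], of C]])
      fix m t assume t: "t \<in> ?S"
      then have t0: "t > 0" using \<epsilon> by simp
      have "\<bar>mode_fun n (real (Suc m)) t\<bar> \<le> sqrt pi * t powr (2 * real n - 1 / 2) * exp (- (pi\<^sup>2 * (real (Suc m))\<^sup>2 / t))"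
        by (rule mode_fun_bound[OF t0]) simp
      \<comment> \<open>The exponent is negative for \<open>n = 0\<close> and positive otherwise;
        split in this way, each factor is monotone for all \<open>n\<close>.\<close>
      also have "t powr (2 * real n - 1 / 2) = t powr (2 * real n) * t powr (- 1 / 2)"
        by (simp add: powr_add[symmetric])
      also have "sqrt pi * (t powr (2 * real n) * t powr (- 1 / 2)) * exp (- (pi\<^sup>2 * (real (Suc m))\<^sup>2 / t)) \<le>
         sqrt pi * ((2 * \<epsilon>) powr (2 * real n) * (\<epsilon> / 2) powr (- 1 / 2)) * exp (- (pi\<^sup>2 * (real (Suc m))\<^sup>2 / (2 * \<epsilon>)))"
      proof -
        have "t powr (2 * real n) \<le> (2 * \<epsilon>) powr (2 * real n)"
          using t t0 by (intro powr_mono2) auto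
        moreover have "t powr (- 1 / 2) \<le> (\<epsilon> / 2) powr (- 1 / 2)"
          using t \<epsilon> by (intro powr_mono2') auto
        ultimately have "sqrt pi * (t powr (2 * real n) * t powr (- 1 / 2)) \<le>
            sqrt pi * ((2 * \<epsilon>) powr (2 * real n) * (\<epsilon> / 2) powr (- 1 / 2))"
          by (intro mult_left_mono mult_mono) auto
        moreover have "pi\<^sup>2 * (real (Suc m))\<^sup>2 / (2 * \<epsilon>) \<le> pi\<^sup>2 * (real (Suc m))\<^sup>2 / t"
          using t t0 \<epsilon> by (intro divide_left_mono) auto
        then have "exp (- (pi\<^sup>2 * (real (Suc m))\<^sup>2 / t)) \<le> exp (- (pi\<^sup>2 * (real (Suc m))\<^sup>2 / (2 * \<epsilon>)))"
          by (simp only: exp_le_cancel_iff neg_le_iff_le)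
        ultimately show ?thesis by (rule mult_mono) auto
      qed
      finally show "norm (- mode_fun n (real (Suc m)) t) \<le> C * exp (- (pi\<^sup>2 * (real (Suc m))\<^sup>2 / (2 * \<epsilon>)))"
        by (simp add: C_def)
    qed (use \<epsilon> in simp)
  qed (use \<epsilon> summable_mode_fun in auto)
  then show ?thesis
    unfolding mode_sum_def[abs_def] suminf_minus[OF summable_mode_fun[OF \<epsilon>]] .
qed

lemma mode_sum_tendsto_0: "(mode_sum (Suc n) \<longlongrightarrow> 0) (at_right 0)"
proof (rule Lim_null_comparison)
  define C where "C = (\<Sum>m. exp (- (pi\<^sup>2 * (real (Suc m))\<^sup>2 / 1)))"
  show "((\<lambda>t. sqrt pi * t * C) \<longlongrightarrow> 0) (at_right 0)"
  proof -
    have "((\<lambda>t. sqrt pi * t * C) \<longlongrightarrow> sqrt pi * 0 * C) (at_right 0)" by (intro tendsto_intros)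
    then show ?thesis by simp
  qed
  have "eventually (\<lambda>t::real. t \<in> {0<..<1}) (at_right 0)" by (rule eventually_at_right_real) simp
  then show "eventually (\<lambda>t. norm (mode_sum (Suc n) t) \<le> sqrt pi * t * C) (at_right 0)"
  proof eventually_elim
    case (elim t)
    then have t: "t > 0" "t \<le> 1" by auto
    have b: "norm (mode_fun (Suc n) (real (Suc m)) t) \<le> sqrt pi * t * exp (- (pi\<^sup>2 * (real (Suc m))\<^sup>2 / 1))" for m
    proof -
      \<comment> \<open>The exponent is at least \<open>3 / 2\<close>, so for
        \<open>t \<le> 1\<close> a single factor \<open>t\<close> can be kept; it already forces the
        limit 0.\<close>
      have "t powr (2 * real (Suc n) - 1 / 2) \<le> t powr 1"
        using t by (intro powr_mono') auto
      then have p: "t powr (2 * real (Suc n) - 1 / 2) \<le> t" using t by simp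
      have e: "exp (- (pi\<^sup>2 * (real (Suc m))\<^sup>2 / t)) \<le> exp (- (pi\<^sup>2 * (real (Suc m))\<^sup>2 / 1))"
      proof -
        have "pi\<^sup>2 * (real (Suc m))\<^sup>2 / 1 \<le> pi\<^sup>2 * (real (Suc m))\<^sup>2 / t"
          using t by (intro divide_left_mono) auto
        then show ?thesis by (simp only: exp_le_cancel_iff neg_le_iff_le)
      qed
      have "norm (mode_fun (Suc n) (real (Suc m)) t) \<le>
          sqrt pi * t powr (2 * real (Suc n) - 1 / 2) * exp (- (pi\<^sup>2 * (real (Suc m))\<^sup>2 / t))"
        using mode_fun_bound[OF t(1), of "real (Suc m)" "Suc n"] by simp
      also have "\<dots> \<le> sqrt pi * t * exp (- (pi\<^sup>2 * (real (Suc m))\<^sup>2 / 1))"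
        using t by (intro mult_mono[OF mult_left_mono[OF p] e]) auto
      finally show ?thesis .
    qed
    have "norm (mode_sum (Suc n) t) \<le> (\<Sum>m. sqrt pi * t * exp (- (pi\<^sup>2 * (real (Suc m))\<^sup>2 / 1)))"
      unfolding mode_sum_def
      by (intro norm_suminf_le b summable_mult summable_exp_modes) simp
    also have "\<dots> = sqrt pi * t * C"
      unfolding C_def by (rule suminf_mult[OF summable_exp_modes]) simp
    finally show ?case .
  qed
qed

text \<open>This is what makes the half-integer powers obey the same descent under differentiation
  as the series and the modes.\<close>

lemma half_power_coeff_Suc: "(real n + 1 / 2) * half_power_coeff (Suc n) = - half_power_coeff n"
proof -
  have "double_fact (2 * int n - 1) \<noteq> 0"
    using double_fact_eq[of n] by (metis fact_nonzero divide_eq_0_iff mult_eq_0_iff of_int_0 power_eq_0_iff zero_neq_numeral)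
  then have d: "real_of_int (double_fact (2 * int n - 1)) \<noteq> 0" by simp
  define t where "t = 2 * real n + 1"
  have t: "t \<noteq> 0" "real n + 1 / 2 = t / 2" "real_of_int (2 * int n + 1) = t"
    unfolding t_def by (simp_all add: add_nonneg_eq_0_iff)
  show ?thesis
    unfolding half_power_coeff_def double_fact_Suc of_int_mult t(2,3) using d t(1) by simp
qed

theorem damped_zeta_expansion:
  assumes "\<epsilon> > 0"
  shows "damped_zeta n \<epsilon> = (\<Sum>j\<le>n. (- 1) ^ j / fact j * zeta_value (n - j) * \<epsilon> ^ j)
    + half_power_coeff n * \<epsilon> powr (real n - 1 / 2) + mode_sum n \<epsilon>"
  using assms
proof (induction n arbitrary: \<epsilon>)
  case 0
  have s: "sqrt (pi / \<epsilon>) = sqrt pi * \<epsilon> powr (- 1 / 2)"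
    using 0 by (simp add: real_sqrt_divide powr_minus_divide powr_half_sqrt)
  have t: "mode_fun 0 (real (Suc m)) \<epsilon> = sqrt (pi / \<epsilon>) * exp (- pi\<^sup>2 * (real (Suc m))\<^sup>2 / \<epsilon>)" for m
    unfolding s using 0 by (simp add: mode_fun_def power_mult_distrib power_divide)
  have "mode_sum 0 \<epsilon> = sqrt (pi / \<epsilon>) * (\<Sum>m. exp (- pi\<^sup>2 * (real (Suc m))\<^sup>2 / \<epsilon>))"
    unfolding mode_sum_def t by (rule suminf_mult) (use summable_exp_modes[OF 0] in simp)
  moreover have "half_power_coeff 0 * \<epsilon> powr (- 1 / 2) = sqrt (pi / \<epsilon>) / 2"
    using s by (simp add: half_power_coeff_def double_fact_def)
  ultimately show ?case
    using theta_inversion[OF 0] by (simp add: damped_zeta_def zeta_value_def)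
next
  case (Suc n)
  define q where "q = (\<lambda>n t. \<Sum>j\<le>n. (- 1) ^ j / fact j * zeta_value (n - j) * t ^ j)"
  \<comment> \<open>The defect of the claim for \<open>Suc n\<close>. By the induction hypothesis
    its derivative vanishes on the positive axis, so it is constant there and its limit at 0
    decides.\<close>
  define F where "F = (\<lambda>t. damped_zeta (Suc n) t - (q (Suc n) t + half_power_coeff (Suc n) * t powr (real n + 1 / 2)
      + mode_sum (Suc n) t))"
  have qS: "q (Suc n) t = zeta_value (Suc n) + (\<Sum>j\<le>n. (- 1) ^ Suc j / fact (Suc j) * zeta_value (n - j) * t ^ Suc j)" for t
    unfolding q_def by (subst sum.atMost_Suc_shift) simp
  have dq: "(q (Suc n) has_real_derivative - q n t) (at t)" for t
  proof -
    have "((\<lambda>t. zeta_value (Suc n) + (\<Sum>j\<le>n. (- 1) ^ Suc j / fact (Suc j) * zeta_value (n - j) * t ^ Suc j)) has_real_derivative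
       0 + (\<Sum>j\<le>n. (- 1) ^ Suc j / fact (Suc j) * zeta_value (n - j) * (real (Suc j) * t ^ j))) (at t)"
      by (intro DERIV_add DERIV_const DERIV_sum DERIV_cmult) (use DERIV_pow[of "Suc _"] in simp)
    moreover have "0 + (\<Sum>j\<le>n. (- 1) ^ Suc j / fact (Suc j) * zeta_value (n - j) * (real (Suc j) * t ^ j)) = - q n t"
      unfolding q_def add_0 sum_negf[symmetric]
      by (intro sum.cong refl) (simp add: fact_Suc field_simps del: of_nat_Suc)
    ultimately show ?thesis unfolding qS[abs_def] by (simp only:)
  qed
  have dF: "(F has_real_derivative 0) (at t)" if t: "t > 0" for t
  proof -
    have dp: "((\<lambda>t. half_power_coeff (Suc n) * t powr (real n + 1 / 2)) has_real_derivative
        - (half_power_coeff n * t powr (real n - 1 / 2))) (at t)"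
    proof -
      have "((\<lambda>t. half_power_coeff (Suc n) * t powr (real n + 1 / 2)) has_real_derivative
          half_power_coeff (Suc n) * ((real n + 1 / 2) * t powr (real n + 1 / 2 - 1))) (at t)"
        by (intro DERIV_cmult has_real_derivative_powr t)
      moreover have "half_power_coeff (Suc n) * ((real n + 1 / 2) * t powr (real n + 1 / 2 - 1)) =
          ((real n + 1 / 2) * half_power_coeff (Suc n)) * t powr (real n - 1 / 2)"
        by simp
      ultimately show ?thesis unfolding half_power_coeff_Suc by simp
    qed
    have "(F has_real_derivative - damped_zeta n t - (- q n t + - (half_power_coeff n * t powr (real n - 1 / 2)) + - mode_sum n t)) (at t)"
      unfolding F_def
      by (intro DERIV_diff DERIV_add dp dq damped_zeta_has_real_derivative[OF t] mode_sum_has_real_derivative[OF t])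
    moreover have "- damped_zeta n t - (- q n t + - (half_power_coeff n * t powr (real n - 1 / 2)) + - mode_sum n t) = 0"
      using Suc.IH[OF t] by (simp add: q_def)
    ultimately show ?thesis by simp
  qed
  have "\<exists>c. \<forall>t\<in>{0<..}. F t = c"
    by (rule has_field_derivative_zero_constant) (use dF in \<open>auto intro: has_field_derivative_at_within\<close>)
  then obtain c where c: "\<And>t. t > 0 \<Longrightarrow> F t = c" by auto
  have "(F \<longlongrightarrow> c) (at_right 0)"
    by (rule tendsto_eventually) (use c in \<open>auto simp: eventually_at_filter\<close>)
  moreover have "(F \<longlongrightarrow> 0) (at_right 0)"
  proof -
    have "((\<lambda>t::real. t powr (real n + 1 / 2)) \<longlongrightarrow> 0 powr (real n + 1 / 2)) (at_right 0)"
      by (rule tendsto_powr') (auto intro!: tendsto_intros simp: eventually_at_filter)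
    then have p: "((\<lambda>t::real. t powr (real n + 1 / 2)) \<longlongrightarrow> 0) (at_right 0)" by simp
    have "(q (Suc n) \<longlongrightarrow> q (Suc n) 0) (at_right 0)"
      unfolding q_def by (intro tendsto_intros)
    then have q: "(q (Suc n) \<longlongrightarrow> zeta_value (Suc n)) (at_right 0)" unfolding qS[of 0] by simp
    have "(F \<longlongrightarrow> zeta_value (Suc n) - (zeta_value (Suc n) + half_power_coeff (Suc n) * 0 + 0)) (at_right 0)"
      unfolding F_def by (intro tendsto_intros p q damped_zeta_tendsto mode_sum_tendsto_0)
    then show ?thesis by simp
  qed
  ultimately have "c = 0" by (rule tendsto_unique[rotated]) simp
  then have "F \<epsilon> = 0" using c[OF Suc.prems] by simp
  moreover have e: "real (Suc n) - 1 / 2 = real n + 1 / 2" by simp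
  ultimately show ?case
    unfolding e F_def q_def by linarith
qed

section \<open>Asymptotic expansion of a single mode and the final assembly\<close>

lemma fact_times_pochhammer: "fact k * pochhammer (real (Suc k)) j = fact (k + j)"
proof (induction j)
  case (Suc j)
  have "fact k * pochhammer (real (Suc k)) (Suc j) = (fact k * pochhammer (real (Suc k)) j) * (real (Suc k) + real j)"
    by (simp add: pochhammer_Suc mult.assoc)
  also have "\<dots> = fact (k + Suc j)" unfolding Suc by (simp add: algebra_simps)
  finally show ?case .
qed simp

lemma mode_fun_asymptotic:
  fixes n m K :: nat and \<epsilon> :: real
  assumes n: "n \<ge> 1" and m: "m \<ge> 1" and \<epsilon>: "\<epsilon> > 0"
  defines "c \<equiv> \<lambda>k. sqrt pi * pochhammer (2 * real n) (2 * k) / (2 ^ (2 * k) * (- (pi\<^sup>2 * real m ^ 2)) ^ (n + k) * fact k)"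
  shows "\<bar>exp (pi\<^sup>2 * real m ^ 2 / \<epsilon>) * mode_fun n (real m) \<epsilon> - (\<Sum>k\<le>K. c k * \<epsilon> powr (2 * real n - 1 / 2 + real k))\<bar>
     \<le> \<bar>c (Suc K)\<bar> * \<epsilon> powr (2 * real n - 1 / 2 + real (Suc K))"
proof -
  define x where "x = pi * real m / sqrt \<epsilon>"
  define a where "a = pi\<^sup>2 * real m ^ 2"
  define C where "C = (- 4) ^ n * sqrt pi * \<epsilon> powr (real n - 1 / 2)"
  have x: "x > 0" and a: "a > 0" using \<epsilon> m by (simp_all add: x_def a_def)
  have x2: "x\<^sup>2 = a / \<epsilon>" using \<epsilon> by (simp add: x_def a_def power_mult_distrib power_divide)
  define k where "k = 2 * n - 1"
  have k: "2 * n = Suc k" "2 * real n = real (Suc k)" using n by (simp_all add: k_def)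
  \<comment> \<open>Used twice: for the terms of the expansion, and with \<open>j = Suc K\<close>
    for the first omitted term that bounds the error. The sign \<open>(- 1) ^ j\<close> is kept
    apart because the error bound for \<open>ierfc\<close> carries none.\<close>
  have trm: "C * (fact (k + 2 * j) / (fact j * fact k * (2 * x) ^ Suc (k + 2 * j))) =
      (- 1) ^ j * (c j * \<epsilon> powr (2 * real n - 1 / 2 + real j))" for j
  proof -
    have "Suc (k + 2 * j) = 2 * (n + j)" using k by simp
    then have xx: "(2 * x) ^ Suc (k + 2 * j) = 4 ^ n * 4 ^ j * (a / \<epsilon>) ^ (n + j)"
      by (simp only: power_mult power_mult_distrib x2 power_add) simp
    have f: "fact (k + 2 * j) = fact k * pochhammer (2 * real n) (2 * j)"
      unfolding k(2) by (rule fact_times_pochhammer[symmetric])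
    have "2 * real n - 1 / 2 + real j = (real n - 1 / 2) + real (n + j)" by simp
    then have pw: "\<epsilon> powr (2 * real n - 1 / 2 + real j) = \<epsilon> powr (real n - 1 / 2) * \<epsilon> ^ (n + j)"
      using \<epsilon> by (simp only: powr_add powr_realpow)
    have s4: "(- 4 :: real) ^ n = (- 1) ^ n * 4 ^ n" by (simp flip: power_mult_distrib)
    have sa: "(- a) ^ (n + j) = (- 1) ^ n * (- 1) ^ j * a ^ (n + j)"
      by (simp add: power_minus[of a] power_add)
    have t2: "(2::real) ^ (2 * j) = 4 ^ j" by (simp add: power_mult)
    have u: "(- 1 :: real) ^ i * (- 1) ^ i = 1" for i by (simp flip: power_mult_distrib)
    have inv: "1 / (- 1 :: real) ^ i = (- 1) ^ i" for i using u[of i] by (simp add: field_simps)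
    have "(- 1) ^ j * (c j * \<epsilon> powr (2 * real n - 1 / 2 + real j)) =
       ((- 1) ^ j * (1 / (- 1) ^ j)) * (1 / (- 1) ^ n) * (sqrt pi * pochhammer (2 * real n) (2 * j) / (4 ^ j * a ^ (n + j) * fact j)
         * (\<epsilon> powr (real n - 1 / 2) * \<epsilon> ^ (n + j)))"
      unfolding c_def a_def[symmetric] sa t2 pw by (simp add: mult_ac)
    also have "\<dots> = (- 1) ^ n * (sqrt pi * pochhammer (2 * real n) (2 * j) / (4 ^ j * a ^ (n + j) * fact j)
         * (\<epsilon> powr (real n - 1 / 2) * \<epsilon> ^ (n + j)))"
      unfolding inv u by simp
    also have "\<dots> = C * (fact (k + 2 * j) / (fact j * fact k * (2 * x) ^ Suc (k + 2 * j)))"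
      unfolding xx f C_def s4 power_divide using \<epsilon> a by (simp add: mult_ac)
    finally show ?thesis by simp
  qed
  have mf: "exp (pi\<^sup>2 * real m ^ 2 / \<epsilon>) * mode_fun n (real m) \<epsilon> = C * (exp (x\<^sup>2) * ierfc (Suc k) x)"
    unfolding x2 a_def[symmetric] mode_fun_def C_def x_def[symmetric] k(1)[symmetric] by (simp add: mult_ac)
  have sm: "(\<Sum>j\<le>K. c j * \<epsilon> powr (2 * real n - 1 / 2 + real j)) =
      C * (\<Sum>j\<le>K. (- 1) ^ j * fact (k + 2 * j) / (fact j * fact k * (2 * x) ^ Suc (k + 2 * j)))"
    unfolding sum_distrib_left
  proof (intro sum.cong refl)
    fix j
    have "(- 1 :: real) ^ j * (- 1) ^ j = 1" by (simp flip: power_mult_distrib)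
    then have "c j * \<epsilon> powr (2 * real n - 1 / 2 + real j) = (- 1) ^ j * ((- 1) ^ j * (c j * \<epsilon> powr (2 * real n - 1 / 2 + real j)))"
      by (simp only: mult.assoc[symmetric] mult_1)
    then show "c j * \<epsilon> powr (2 * real n - 1 / 2 + real j) =
        C * ((- 1) ^ j * fact (k + 2 * j) / (fact j * fact k * (2 * x) ^ Suc (k + 2 * j)))"
      unfolding trm[symmetric] by (simp only: times_divide_eq_right mult.left_commute)
  qed
  have "\<bar>exp (pi\<^sup>2 * real m ^ 2 / \<epsilon>) * mode_fun n (real m) \<epsilon> - (\<Sum>k\<le>K. c k * \<epsilon> powr (2 * real n - 1 / 2 + real k))\<bar>
     = \<bar>C\<bar> * \<bar>exp (x\<^sup>2) * ierfc (Suc k) x - (\<Sum>j\<le>K. (- 1) ^ j * fact (k + 2 * j) / (fact j * fact k * (2 * x) ^ Suc (k + 2 * j)))\<bar>"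
    unfolding mf sm by (simp only: abs_mult[symmetric] right_diff_distrib)
  also have "\<dots> \<le> \<bar>C\<bar> * (fact (k + 2 * Suc K) / (fact (Suc K) * fact k * (2 * x) ^ Suc (k + 2 * Suc K)))"
    by (intro mult_left_mono ierfc_asymptotic[OF x]) simp
  also have "\<dots> = \<bar>C * (fact (k + 2 * Suc K) / (fact (Suc K) * fact k * (2 * x) ^ Suc (k + 2 * Suc K)))\<bar>"
  proof -
    have "0 \<le> fact (k + 2 * Suc K) / (fact (Suc K) * fact k * (2 * x) ^ Suc (k + 2 * Suc K))"
      using x by (intro divide_nonneg_nonneg mult_nonneg_nonneg zero_le_power) auto
    then show ?thesis by (simp only: abs_mult abs_of_nonneg)
  qed
  also have "\<dots> = \<bar>c (Suc K)\<bar> * \<epsilon> powr (2 * real n - 1 / 2 + real (Suc K))"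
    unfolding trm by (simp only: abs_mult power_abs abs_minus_cancel abs_one power_one mult_1 abs_of_nonneg[OF powr_ge_zero])
  finally show ?thesis .
qed

lemma zeta_value_eq: "riemann_zeta (of_nat (2 * n)) = of_real (zeta_value n)"
  using riemann_zeta_0 riemann_zeta_of_nat[of "2 * n"] by (cases n) (auto simp: zeta_value_def)

theorem mainTheorem1:
  fixes g :: nat
  assumes "g \<ge> 2"
  shows
    "(\<forall>\<epsilon>::real. \<epsilon> > 0 \<longrightarrow>
        summable (\<lambda>l. real (Suc l) powi (2 - 2 * int g) * exp (- \<epsilon> * real (Suc l) ^ 2)) \<and>
        summable (\<lambda>m. H_fun g \<epsilon> (real (Suc m))) \<and>
        complex_of_real (\<Sum>l. real (Suc l) powi (2 - 2 * int g) * exp (- \<epsilon> * real (Suc l) ^ 2)) =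
          (\<Sum>j = 0..g - 1. (-1) ^ j / fact j * riemann_zeta (of_nat (2 * g - 2 - 2 * j))
                            * complex_of_real (\<epsilon> ^ j))
          + complex_of_real ((-1) ^ (g - 1) * sqrt pi * 2 ^ (g - 2)
                              / of_int (double_fact (2 * int g - 3)) * \<epsilon> powr (real g - 3 / 2))
          + (\<Sum>m. H_fun g \<epsilon> (real (Suc m)))) \<and>
     (\<forall>m::nat. m \<ge> 1 \<longrightarrow> (\<forall>K::nat.
        (\<lambda>\<epsilon>::real. complex_of_real (exp (pi\<^sup>2 * real m ^ 2 / \<epsilon>)) * H_fun g \<epsilon> (real m)
            - complex_of_real (\<Sum>k = 0..K.
                sqrt pi * pochhammer (2 * real g - 2) (2 * k)
                / (2 ^ (2 * k) * (- (pi\<^sup>2 * real m ^ 2)) ^ (g - 1 + k) * fact k)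
                * \<epsilon> powr (2 * real g - 5 / 2 + real k)))
        \<in> O[at_right 0](\<lambda>\<epsilon>. complex_of_real (\<epsilon> powr (2 * real g - 5 / 2 + real K + 1)))))"
proof (intro conjI allI impI)
  define n where "n = g - 1"
  have n: "n \<ge> 1" "g = Suc n" using assms by (auto simp: n_def)
  {
    fix \<epsilon> :: real assume \<epsilon>: "\<epsilon> > 0"
    have trm: "real (Suc l) powi (2 - 2 * int g) * exp (- \<epsilon> * real (Suc l) ^ 2) =
        exp (- (\<epsilon> * (real (Suc l))\<^sup>2)) / real (Suc l) ^ (2 * n)" for l
    proof -
      have "2 - 2 * int g = - int (2 * n)" by (simp add: n)
      then show ?thesis by (simp only: power_int_minus power_int_of_nat) (simp add: field_simps del: of_nat_Suc)
    qed
    show "summable (\<lambda>l. real (Suc l) powi (2 - 2 * int g) * exp (- \<epsilon> * real (Suc l) ^ 2))"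
      unfolding trm by (rule summable_damped_zeta[OF \<epsilon>])
    have H: "H_fun g \<epsilon> p = of_real (mode_fun n p \<epsilon>)" for p
      unfolding n_def by (rule H_fun_eq_mode_fun[OF assms \<epsilon>])
    show "summable (\<lambda>m. H_fun g \<epsilon> (real (Suc m)))"
      unfolding H by (intro summable_of_real summable_mode_fun \<epsilon>)
    have Hs: "(\<Sum>m. H_fun g \<epsilon> (real (Suc m))) = of_real (mode_sum n \<epsilon>)"
      unfolding H mode_sum_def by (rule suminf_of_real[symmetric, OF summable_mode_fun[OF \<epsilon>]])
    have z: "(-1) ^ j / fact j * riemann_zeta (of_nat (2 * g - 2 - 2 * j)) * complex_of_real (\<epsilon> ^ j) =
        complex_of_real ((- 1) ^ j / fact j * zeta_value (n - j) * \<epsilon> ^ j)" for j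
    proof -
      have "2 * g - 2 - 2 * j = 2 * (n - j)" using n by simp
      then show ?thesis by (simp only: zeta_value_eq) simp
    qed
    obtain l where l: "n = Suc l" using n by (cases n) auto
    have h: "(-1) ^ (g - 1) * sqrt pi * 2 ^ (g - 2) / of_int (double_fact (2 * int g - 3)) * \<epsilon> powr (real g - 3 / 2) =
        half_power_coeff n * \<epsilon> powr (real n - 1 / 2)"
    proof -
      have "2 * int g - 3 = 2 * int n - 1" "real g - 3 / 2 = real n - 1 / 2" "g - 2 = l" "g - 1 = n"
        using n l by auto
      then show ?thesis by (simp only: half_power_coeff_def) (simp add: l)
    qed
    show "complex_of_real (\<Sum>l. real (Suc l) powi (2 - 2 * int g) * exp (- \<epsilon> * real (Suc l) ^ 2)) =
          (\<Sum>j = 0..g - 1. (-1) ^ j / fact j * riemann_zeta (of_nat (2 * g - 2 - 2 * j))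
                            * complex_of_real (\<epsilon> ^ j))
          + complex_of_real ((-1) ^ (g - 1) * sqrt pi * 2 ^ (g - 2)
                              / of_int (double_fact (2 * int g - 3)) * \<epsilon> powr (real g - 3 / 2))
          + (\<Sum>m. H_fun g \<epsilon> (real (Suc m)))"
      unfolding trm z h Hs unfolding damped_zeta_def[symmetric] damped_zeta_expansion[OF \<epsilon>] n_def[symmetric] atMost_atLeast0
      by (simp only: of_real_add of_real_sum)
  }
  fix m K :: nat assume m: "m \<ge> 1"
  define c where "c = (\<lambda>k. sqrt pi * pochhammer (2 * real n) (2 * k) / (2 ^ (2 * k) * (- (pi\<^sup>2 * real m ^ 2)) ^ (n + k) * fact k))"
  have e: "2 * real g - 2 = 2 * real n" "g - 1 = n" "2 * real g - 5 / 2 = 2 * real n - 1 / 2"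
    "2 * real n - 1 / 2 + real K + 1 = 2 * real n - 1 / 2 + real (Suc K)"
    using n by auto
  show "(\<lambda>\<epsilon>::real. complex_of_real (exp (pi\<^sup>2 * real m ^ 2 / \<epsilon>)) * H_fun g \<epsilon> (real m)
            - complex_of_real (\<Sum>k = 0..K.
                sqrt pi * pochhammer (2 * real g - 2) (2 * k)
                / (2 ^ (2 * k) * (- (pi\<^sup>2 * real m ^ 2)) ^ (g - 1 + k) * fact k)
                * \<epsilon> powr (2 * real g - 5 / 2 + real k)))
        \<in> O[at_right 0](\<lambda>\<epsilon>. complex_of_real (\<epsilon> powr (2 * real g - 5 / 2 + real K + 1)))"
  \<comment> \<open>The error bound for a mode holds for every positive \<open>\<epsilon>\<close>,
    so the size of the first omitted coefficient serves as the constant.\<close>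
  proof (rule bigoI[where c = "\<bar>c (Suc K)\<bar>"])
    show "eventually (\<lambda>\<epsilon>. norm (complex_of_real (exp (pi\<^sup>2 * real m ^ 2 / \<epsilon>)) * H_fun g \<epsilon> (real m)
            - complex_of_real (\<Sum>k = 0..K.
                sqrt pi * pochhammer (2 * real g - 2) (2 * k)
                / (2 ^ (2 * k) * (- (pi\<^sup>2 * real m ^ 2)) ^ (g - 1 + k) * fact k)
                * \<epsilon> powr (2 * real g - 5 / 2 + real k)))
         \<le> \<bar>c (Suc K)\<bar> * norm (complex_of_real (\<epsilon> powr (2 * real g - 5 / 2 + real K + 1)))) (at_right 0)"
      using eventually_at_right_less[of "0::real"]
    proof eventually_elim
      case (elim \<epsilon>)
      show ?case
        unfolding H_fun_eq_mode_fun[OF assms elim] e of_real_mult[symmetric] of_real_diff[symmetric] norm_of_real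
          atMost_atLeast0[symmetric] abs_of_nonneg[OF powr_ge_zero]
        unfolding c_def by (rule mode_fun_asymptotic[OF n(1) m elim])
    qed
  qed
qed

end
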